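(* There is an algorithm which, given a homomorphism $q:F_n\to G$ from a free group of finite rank $n$ to a finite group $G$, computes in finite time the set of all elements of $G$ that are images under $q$ of primitive elements of $F_n$.
   Context: $F_n$ is the free group of rank $n$ with standard basis $a_1,\dots,a_n$; an element is primitive if it is part of a free basis of $F_n$. The input is the finite group $G$ (e.g. given by its multiplication table) together with the tuple $(q(a_1),\dots,q(a_n))\in G^n$. *)

theory Defs
  imports "HOL-Algebra.Group" "HOL-Library.Nat_Bijection"
begin

section \<open>Free groups and primitive elements\<close>

text \<open>A letter \<open>(x, True)\<close> stands for the generator \<open>x\<close>, and \<open>(x, False)\<close> for its inverse.\<close>

definition inv_letter :: "'x \<times> bool \<Rightarrow> 'x \<times> bool" where
  "inv_letter a = (fst a, \<not> snd a)"

definition reduced :: "('x \<times> bool) list \<Rightarrow> bool" where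
  "reduced w \<longleftrightarrow> successively (\<lambda>a b. b \<noteq> inv_letter a) w"

fun push :: "'x \<times> bool \<Rightarrow> ('x \<times> bool) list \<Rightarrow> ('x \<times> bool) list" where
  "push a [] = [a]"
| "push a (b # w) = (if b = inv_letter a then w else a # b # w)"

text \<open>For reduced \<open>v\<close>, \<open>foldr push u v\<close> is the reduced form of the concatenation \<open>u @ v\<close>.\<close>

definition free_group :: "'x set \<Rightarrow> ('x \<times> bool) list monoid" where
  "free_group X =
     \<lparr>carrier = {w. reduced w \<and> fst ` set w \<subseteq> X},
      mult = (\<lambda>u v. foldr push u v),
      one = []\<rparr>"

definition free_gen :: "'x \<Rightarrow> ('x \<times> bool) list" where
  "free_gen x = [(x, True)]"

definition word_val :: "('a, 'b) monoid_scheme \<Rightarrow> ('a \<times> bool) list \<Rightarrow> 'a" where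
  "word_val G w =
     foldr (\<lambda>(x, b) y. (if b then x else inv\<^bsub>G\<^esub> x) \<otimes>\<^bsub>G\<^esub> y) w \<one>\<^bsub>G\<^esub>"

text \<open>\<open>B\<close> is a free basis: every element is the value of exactly one reduced word over \<open>B\<close>.\<close>

definition free_basis :: "('a, 'b) monoid_scheme \<Rightarrow> 'a set \<Rightarrow> bool" where
  "free_basis G B \<longleftrightarrow>
     B \<subseteq> carrier G \<and> bij_betw (word_val G) (carrier (free_group B)) (carrier G)"

definition primitive :: "('a, 'b) monoid_scheme \<Rightarrow> 'a \<Rightarrow> bool" where
  "primitive G x \<longleftrightarrow> (\<exists>B. free_basis G B \<and> x \<in> B)"

lemma inv_letter_inv_letter [simp]: "inv_letter (inv_letter a) = a"
  by (simp add: inv_letter_def)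

lemma inv_letter_neq [simp]: "inv_letter a \<noteq> a" "a \<noteq> inv_letter a"
  by (simp_all add: inv_letter_def prod_eq_iff)

lemma reduced_Nil [simp]: "reduced []"
  by (simp add: reduced_def)

lemma reduced_Cons: "reduced (a # w) \<longleftrightarrow> reduced w \<and> (w = [] \<or> hd w \<noteq> inv_letter a)"
  by (cases w) (auto simp: reduced_def)

lemma reduced_push: "reduced w \<Longrightarrow> reduced (push a w)"
  by (cases w) (auto simp: reduced_Cons)

lemma push_inv_letter: "reduced w \<Longrightarrow> push (inv_letter a) (push a w) = w"
  by (cases w; cases "tl w") (auto simp: reduced_Cons)

lemma push_reduced: "reduced (a # w) \<Longrightarrow> push a w = a # w"
  by (cases w) (auto simp: reduced_Cons)

lemma reduced_foldr_push: "reduced v \<Longrightarrow> reduced (foldr push u v)"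
  by (induction u) (auto simp: reduced_push)

lemma foldr_push_Nil: "reduced u \<Longrightarrow> foldr push u [] = u"
proof (induction u)
  case (Cons a u)
  then show ?case using push_reduced[of a u] by (simp add: reduced_Cons)
qed simp

lemma foldr_push_push:
  assumes "reduced v" "reduced w"
  shows "foldr push (push a v) w = push a (foldr push v w)"
proof (cases v)
  case (Cons b v')
  show ?thesis
    using push_inv_letter[OF reduced_foldr_push[OF assms(2), of v'], of "inv_letter a"]
    by (auto simp: Cons)
qed simp

lemma foldr_push_assoc:
  assumes "reduced v" "reduced w"
  shows "foldr push (foldr push u v) w = foldr push u (foldr push v w)"
  using assms by (induction u) (auto simp: foldr_push_push reduced_foldr_push)

lemma set_push: "set (push a w) \<subseteq> insert a (set w)"
  by (cases w) auto

lemma set_foldr_push: "set (foldr push u v) \<subseteq> set u \<union> set v"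
proof (induction u)
  case (Cons a u)
  then show ?case using set_push[of a "foldr push u v"] by auto
qed simp

lemma foldr_push_snoc_inverse:
  "reduced w \<Longrightarrow> foldr push (rev (map inv_letter u)) (foldr push u w) = w"
  by (induction u arbitrary: w) (auto simp: push_inv_letter reduced_foldr_push)

lemma group_free_group: "group (free_group X)"
proof (rule groupI)
  fix u assume u: "u \<in> carrier (free_group X)"
  let ?v = "foldr push (rev (map inv_letter u)) []"
  have "fst ` set ?v \<subseteq> X"
    using u set_foldr_push[of "rev (map inv_letter u)" "[]"]
    by (force simp: free_group_def inv_letter_def)
  moreover have "reduced ?v"
    by (simp add: reduced_foldr_push)
  moreover have "foldr push ?v u = []"
    using u foldr_push_assoc[of "[]" u] foldr_push_snoc_inverse[of "[]" u]
    by (simp add: free_group_def foldr_push_Nil)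
  ultimately show "\<exists>v\<in>carrier (free_group X). v \<otimes>\<^bsub>free_group X\<^esub> u = \<one>\<^bsub>free_group X\<^esub>"
    by (auto simp: free_group_def)
next
  fix u v assume "u \<in> carrier (free_group X)" "v \<in> carrier (free_group X)"
  then show "u \<otimes>\<^bsub>free_group X\<^esub> v \<in> carrier (free_group X)"
    using set_foldr_push[of u v] by (fastforce simp: free_group_def reduced_foldr_push)
qed (auto simp: free_group_def foldr_push_assoc)

lemma free_basis_free_group: "free_basis (free_group X) (free_gen ` X)"
proof -
  let ?F = "free_group X"
  let ?g = "\<lambda>a. (free_gen (fst a), snd a) :: ('a \<times> bool) list \<times> bool"
  interpret group ?F by (rule group_free_group)
  have gen: "free_gen x \<in> carrier ?F" if "x \<in> X" for x
    using that by (simp add: free_group_def free_gen_def reduced_Cons)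
  have inv_gen: "inv\<^bsub>?F\<^esub> (free_gen x) = [(x, False)]" if "x \<in> X" for x
    using that by (intro inv_equality gen)
      (auto simp: free_group_def free_gen_def reduced_Cons inv_letter_def)
  have val: "word_val ?F (map ?g w) = w" if "w \<in> carrier ?F" for w
    using that
  proof (induction w)
    case Nil
    show ?case by (simp add: word_val_def free_group_def)
  next
    case (Cons a w)
    obtain x b where a: "a = (x, b)" by force
    have w: "w \<in> carrier ?F" and x: "x \<in> X"
      using Cons.prems by (auto simp: free_group_def reduced_Cons a)
    have "word_val ?F (map ?g (a # w)) = [(x, b)] \<otimes>\<^bsub>?F\<^esub> word_val ?F (map ?g w)"
      using inv_gen[OF x] by (simp add: word_val_def a free_gen_def)
    also have "\<dots> = push a w"
      unfolding Cons.IH[OF w] by (simp add: free_group_def a)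
    also have "\<dots> = a # w"
      using Cons.prems by (intro push_reduced) (simp add: free_group_def)
    finally show ?case .
  qed
  have inj: "?g b \<noteq> inv_letter (?g a) \<longleftrightarrow> b \<noteq> inv_letter a" for a b
    by (auto simp: inv_letter_def free_gen_def prod_eq_iff)
  have red: "reduced (map ?g w) \<longleftrightarrow> reduced w" for w :: "('a \<times> bool) list"
    unfolding reduced_def successively_map inj ..
  have img: "map ?g ` carrier ?F = carrier (free_group (free_gen ` X))"
  proof (intro equalityI subsetI)
    fix v assume "v \<in> map ?g ` carrier ?F"
    then show "v \<in> carrier (free_group (free_gen ` X))"
      by (fastforce simp: free_group_def red)
  next
    fix v assume v: "v \<in> carrier (free_group (free_gen ` X))"
    define w where "w = map (\<lambda>a. (fst (hd (fst a)), snd a)) v"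
    have "fst a \<in> free_gen ` X" if "a \<in> set v" for a
      using v that by (auto simp: free_group_def)
    then have "map ?g w = v"
      unfolding w_def map_map by (intro map_idI) (fastforce simp: free_gen_def)
    moreover from this have "w \<in> carrier ?F"
      using v red[of w] unfolding free_group_def w_def
      by (fastforce simp: free_gen_def)
    ultimately show "v \<in> map ?g ` carrier ?F"
      by force
  qed
  have "bij_betw (word_val ?F) (map ?g ` carrier ?F) (carrier ?F)"
    by (rule bij_betw_byWitness[where f' = "map ?g"]) (auto simp: val)
  then show ?thesis
    using gen by (auto simp: free_basis_def img)
qed

section \<open>Algorithms\<close>

text \<open>Algorithms are Kleene's partial recursive (\<open>\<mu>\<close>-recursive) function terms;
  \<open>evaluates f xs y\<close> says that \<open>f\<close> halts on the arguments \<open>xs\<close> with result \<open>y\<close>.\<close>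

datatype recf =
    Zero
  | Succ
  | Proj nat
  | Comp recf "recf list"
  | Prec recf recf
  | Mu recf

inductive evaluates :: "recf \<Rightarrow> nat list \<Rightarrow> nat \<Rightarrow> bool" where
  Zero: "evaluates Zero xs 0"
| Succ: "evaluates Succ [x] (Suc x)"
| Proj: "i < length xs \<Longrightarrow> evaluates (Proj i) xs (xs ! i)"
| Comp: "list_all2 (\<lambda>g y. evaluates g xs y) gs ys \<Longrightarrow> evaluates f ys z \<Longrightarrow>
         evaluates (Comp f gs) xs z"
| Prec_0: "evaluates f xs y \<Longrightarrow> evaluates (Prec f g) (0 # xs) y"
| Prec_Suc: "evaluates (Prec f g) (k # xs) r \<Longrightarrow> evaluates g (k # r # xs) y \<Longrightarrow>
             evaluates (Prec f g) (Suc k # xs) y"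
| Mu: "evaluates f (k # xs) 0 \<Longrightarrow> (\<forall>j<k. \<exists>y. evaluates f (j # xs) (Suc y)) \<Longrightarrow>
       evaluates (Mu f) xs k"

lemma evaluates_deterministic:
  assumes "evaluates f xs y" "evaluates f xs z"
  shows "y = z"
  using assms
proof (induction arbitrary: z rule: evaluates.induct)
  case (Comp xs gs ys f z')
  from Comp.prems obtain ys' where ys': "list_all2 (\<lambda>g y. evaluates g xs y) gs ys'"
    and f: "evaluates f ys' z" by (cases rule: evaluates.cases) auto
  have "ys = ys'"
  proof (rule nth_equalityI)
    show "length ys = length ys'"
      using Comp.IH(1) ys' by (simp add: list_all2_conv_all_nth)
    show "ys ! i = ys' ! i" if "i < length ys" for i
      using that Comp.IH(1) ys' by (auto simp: list_all2_conv_all_nth)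
  qed
  then show ?case using f Comp.IH(2) by blast
next
  case (Prec_Suc f g k xs r y)
  from Prec_Suc.prems obtain r' where "evaluates (Prec f g) (k # xs) r'"
    "evaluates g (k # r' # xs) z" by (cases rule: evaluates.cases) auto
  then show ?case using Prec_Suc.IH by blast
next
  case (Mu f k xs)
  from Mu.prems have z: "evaluates f (z # xs) 0"
    "\<forall>j<z. \<exists>y. evaluates f (j # xs) (Suc y)" by (cases rule: evaluates.cases; auto)+
  have "\<not> k < z" using z(2) Mu.IH(1) by fastforce
  moreover have "\<not> z < k" using z(1) Mu.IH(2) by fastforce
  ultimately show ?case by simp
qed (erule evaluates.cases; auto)+

section \<open>Encoding of the input\<close>

text \<open>The elements of the finite group \<open>G\<close> of order \<open>m\<close> are named by the numbers below \<open>m\<close>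
  through a bijection \<open>e\<close>. An algorithm sees only these names: \<open>G\<close> is passed as its
  multiplication table, row by row, and \<open>q\<close> as the tuple of the images of the standard basis.
  Isomorphic groups have the same tables, so an algorithm that is correct for all finite groups
  with elements in \<open>nat\<close> is correct for all finite groups over every type.\<close>

definition elem_code :: "nat \<Rightarrow> (nat \<Rightarrow> 'a) \<Rightarrow> 'a \<Rightarrow> nat" where
  "elem_code m e = inv_into {..<m} e"

definition table_code :: "('a, 'b) monoid_scheme \<Rightarrow> nat \<Rightarrow> (nat \<Rightarrow> 'a) \<Rightarrow> nat" where
  "table_code G m e =
     list_encode (map (\<lambda>i. list_encode (map (\<lambda>j. elem_code m e (e i \<otimes>\<^bsub>G\<^esub> e j)) [0..<m])) [0..<m])"

definition tuple_code ::
    "nat \<Rightarrow> (nat \<Rightarrow> 'a) \<Rightarrow> nat \<Rightarrow> ((nat \<times> bool) list \<Rightarrow> 'a) \<Rightarrow> nat" where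
  "tuple_code m e n q = list_encode (map (\<lambda>i. elem_code m e (q (free_gen i))) [0..<n])"

end

theory Submission imports Defs begin

text \<open>An element of \<open>F\<^sub>n\<close> is primitive iff it is a component of a basis, and by Nielsen's theorem the
bases of \<open>F\<^sub>n\<close> are the tuples that arise from the standard basis by finitely many Nielsen moves:
invert a component, or multiply a component by another one. A homomorphism \<open>q\<close> commutes with
these moves. So the images of the primitive elements are the components of the tuples
in \<open>G\<^sup>n\<close> that are reached from \<open>(q(a\<^sub>1), \<dots>, q(a\<^sub>n))\<close> by Nielsen moves in \<open>G\<close>
(\<open>image_primitive_eq_nielsen\<close>). There are only finitely many tuples in \<open>G\<^sup>n\<close>, so this orbit can be
computed.

Nielsen's theorem. That the moves preserve bases holds because each move is induced by an
automorphism of \<open>F\<^sub>n\<close> (\<open>basis_family_nielsen\<close>). Conversely, among all tuples that are reached from a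
given basis, take one of least total length and, among those, of least total weight,
where the weight of a word is a number read off from its first half and the first half of its
inverse. Minimality of the length says that, unless two factors are inverse to each other, at most
half of each cancels in their product. Minimality of the weight excludes that a factor is eaten up by
its two neighbours from both sides at once (\<open>nielsen_reduced_of_move_minimal\<close>). Hence in a reduced
product of \<open>k\<close> factors every factor leaves a letter, and the product has length at least \<open>k\<close>
(\<open>length_nielsen_reduced_product\<close>). A generator \<open>a\<^sub>i\<close> has length one, so it is itself a component or
the inverse of one, and freeness leaves room for no other components: the minimal basis is the
standard basis up to order and signs (\<open>nielsen_connects_bases\<close>).

The algorithm. Finite sets are coded by binary numbers, and a proper subset has a smaller code. So
the least \<open>C\<close> that codes a set of tuples containing the input tuple and closed under the moves holds
exactly the tuples of the orbit, and the least \<open>D\<close> that codes a set containing all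
components of members of \<open>C\<close> codes the set of components. Both are found by unbounded search
(\<open>Mu\<close>) for a property that is decidable since all its quantifiers are bounded
(\<open>entries_algorithm\<close>, \<open>least_orbit_entries\<close>).\<close>

section \<open>Homomorphisms from free groups\<close>

text \<open>The homomorphism from the free group that sends the generator \<open>x\<close> to \<open>f x\<close>. Unlike \<open>word_val\<close>, it
separates the generators, which serve as indices, from their images. So a tuple keeps its indices
when a move changes its values.\<close>

definition free_ext :: "('a, 'b) monoid_scheme \<Rightarrow> ('i \<Rightarrow> 'a) \<Rightarrow> ('i \<times> bool) list \<Rightarrow> 'a" where
  "free_ext H f w = word_val H (map (apfst f) w)"

lemma free_ext_Nil [simp]: "free_ext H f [] = \<one>\<^bsub>H\<^esub>"
  by (simp add: free_ext_def word_val_def)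

lemma free_ext_Cons [simp]:
  "free_ext H f ((x, b) # w) = (if b then f x else inv\<^bsub>H\<^esub> f x) \<otimes>\<^bsub>H\<^esub> free_ext H f w"
  by (simp add: free_ext_def word_val_def)

lemma free_ext_id [simp]: "free_ext H (\<lambda>x. x) = word_val H"
  by (simp add: free_ext_def fun_eq_iff apfst_def map_prod_def)

lemma free_ext_cong:
  "(\<And>x. x \<in> fst ` set w \<Longrightarrow> f x = g x) \<Longrightarrow> free_ext H f w = free_ext H g w"
  by (induction w) auto

lemma Nil_in_free_group [simp]: "[] \<in> carrier (free_group X)"
  by (simp add: free_group_def)

lemma one_free_group: "\<one>\<^bsub>free_group X\<^esub> = []"
  by (simp add: free_group_def)

lemma mult_free_group: "u \<otimes>\<^bsub>free_group X\<^esub> v = foldr push u v"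
  by (simp add: free_group_def)

lemma letter_in_free_group [simp]: "[(x, b)] \<in> carrier (free_group X) \<longleftrightarrow> x \<in> X"
  by (simp add: free_group_def reduced_Cons)

lemma free_gen_in_free_group [simp]: "free_gen x \<in> carrier (free_group X) \<longleftrightarrow> x \<in> X"
  by (simp add: free_gen_def)

lemma Cons_in_free_groupD:
  assumes "(x, b) # w \<in> carrier (free_group X)"
  shows "x \<in> X" "w \<in> carrier (free_group X)" "(x, b) # w = [(x, b)] \<otimes>\<^bsub>free_group X\<^esub> w"
  using assms push_reduced[of "(x, b)" w] by (auto simp: free_group_def reduced_Cons)

lemma inv_free_group:
  assumes "u \<in> carrier (free_group X)"
  shows "inv\<^bsub>free_group X\<^esub> u = rev (map inv_letter u)"
proof -
  interpret F: group "free_group X" by (rule group_free_group)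
  have "reduced (rev (map inv_letter u))"
  proof -
    have "successively (\<lambda>a b. b \<noteq> inv_letter a) u"
      using assms by (simp add: free_group_def reduced_def)
    then have "successively (\<lambda>a b. inv_letter a \<noteq> b) u"
      by (rule successively_mono) auto
    then show ?thesis
      unfolding reduced_def successively_rev successively_map inv_letter_inv_letter .
  qed
  moreover have "foldr push (rev (map inv_letter u)) u = []"
    using assms foldr_push_snoc_inverse[of "[]" u]
    by (simp add: free_group_def foldr_push_Nil)
  ultimately show ?thesis
    using assms by (intro F.inv_equality) (force simp: free_group_def inv_letter_def)+
qed

lemma inv_letter_free_group:
  assumes "x \<in> X"
  shows "inv\<^bsub>free_group X\<^esub> [(x, b)] = [(x, \<not> b)]"
  using assms by (simp add: inv_free_group inv_letter_def)

context group
begin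

lemma free_ext_closed [intro]:
  "f \<in> I \<rightarrow> carrier G \<Longrightarrow> fst ` set w \<subseteq> I \<Longrightarrow> free_ext G f w \<in> carrier G"
  by (induction w) (auto simp: Pi_iff)

lemma free_ext_push:
  assumes "f \<in> I \<rightarrow> carrier G" "fst ` set (a # w) \<subseteq> I"
  shows "free_ext G f (push a w) = free_ext G f (a # w)"
proof (cases w)
  case (Cons b w')
  have *: "f (fst a) \<in> carrier G" "free_ext G f w' \<in> carrier G"
    using assms by (auto simp: Cons)
  show ?thesis
    using * by (cases a) (auto simp: Cons inv_letter_def m_assoc[symmetric])
qed simp

lemma free_ext_foldr_push:
  assumes "f \<in> I \<rightarrow> carrier G" "fst ` set u \<subseteq> I" "fst ` set v \<subseteq> I"
  shows "free_ext G f (foldr push u v) = free_ext G f u \<otimes> free_ext G f v"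
  using assms(2)
proof (induction u)
  case Nil
  then show ?case using assms by (simp add: free_ext_closed)
next
  case (Cons a u)
  have *: "fst ` set (a # foldr push u v) \<subseteq> I"
    using Cons.prems assms(3) set_foldr_push[of u v] by fastforce
  have **: "f (fst a) \<in> carrier G" "free_ext G f u \<in> carrier G" "free_ext G f v \<in> carrier G"
    using Cons.prems assms by (auto intro!: free_ext_closed[of f I])
  show ?case
    using Cons ** free_ext_push[OF assms(1) *] by (cases a) (simp add: m_assoc)
qed

lemma free_ext_hom:
  assumes "f \<in> I \<rightarrow> carrier G"
  shows "free_ext G f \<in> hom (free_group I) G"
  using assms
  by (auto simp: hom_def free_group_def free_ext_foldr_push intro!: free_ext_closed[of f I])

lemma free_ext_free_gen [simp]: "f x \<in> carrier G \<Longrightarrow> free_ext G f (free_gen x) = f x"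
  by (simp add: free_gen_def)

end

text \<open>Uniqueness in the universal property of free groups.\<close>

lemma hom_free_group_eq_free_ext:
  assumes "group H" "h \<in> hom (free_group I) H" "w \<in> carrier (free_group I)"
  shows "h w = free_ext H (\<lambda>i. h (free_gen i)) w"
proof -
  interpret group_hom "free_group I" H h
    using assms group_free_group by (simp add: group_hom_def group_hom_axioms_def)
  show ?thesis
    using assms(3)
  proof (induction w)
    case Nil
    then show ?case using hom_one by (simp add: one_free_group)
  next
    case (Cons a w)
    obtain x b where a: "a = (x, b)" by force
    note w = Cons_in_free_groupD[OF Cons.prems[unfolded a]]
    have "h [(x, b)] = (if b then h (free_gen x) else inv\<^bsub>H\<^esub> h (free_gen x))"
      using w(1) hom_inv[of "free_gen x"] inv_letter_free_group[of x I True]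
      by (simp add: free_gen_def)
    then show ?case
      using w(1,2) Cons.IH hom_mult[of "[(x, b)]" w] unfolding a w(3)[symmetric] by simp
  qed
qed

lemma hom_free_ext:
  assumes "group H" "group K" "h \<in> hom H K" "f \<in> I \<rightarrow> carrier H" "w \<in> carrier (free_group I)"
  shows "h (free_ext H f w) = free_ext K (\<lambda>i. h (f i)) w"
proof -
  have "(h \<circ> free_ext H f) \<in> hom (free_group I) K"
    using assms by (intro hom_compose[of _ _ H] group.free_ext_hom)
  then have "(h \<circ> free_ext H f) w = free_ext K (\<lambda>i. (h \<circ> free_ext H f) (free_gen i)) w"
    using assms(2,5) by (intro hom_free_group_eq_free_ext)
  also have "\<dots> = free_ext K (\<lambda>i. h (f i)) w"
    using assms
    by (intro free_ext_cong) (auto simp: free_group_def Pi_iff group.free_ext_free_gen)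
  finally show ?thesis by simp
qed

lemma free_ext_gens:
  assumes "w \<in> carrier (free_group I)"
  shows "free_ext (free_group I) free_gen w = w"
  using hom_free_group_eq_free_ext[OF group_free_group, of "\<lambda>w. w" I I w] assms
  by (simp add: hom_def)

section \<open>Indexed bases\<close>

text \<open>A free basis listed by an index set. Being a bijection from words in the indices, rather than from
words in the values, the condition includes that \<open>f\<close> takes distinct values.\<close>

definition basis_family :: "('a, 'b) monoid_scheme \<Rightarrow> 'i set \<Rightarrow> ('i \<Rightarrow> 'a) \<Rightarrow> bool" where
  "basis_family H I f \<longleftrightarrow> f \<in> I \<rightarrow> carrier H \<and>
     bij_betw (free_ext H f) (carrier (free_group I)) (carrier H)"

lemma free_basis_iff_basis_family: "free_basis H B \<longleftrightarrow> basis_family H B (\<lambda>x. x)"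
  by (auto simp: free_basis_def basis_family_def)

lemma basis_family_free_gen: "basis_family (free_group X) X free_gen"
proof -
  have "bij_betw (free_ext (free_group X) free_gen) (carrier (free_group X)) (carrier (free_group X))
    \<longleftrightarrow> bij_betw (\<lambda>w. w) (carrier (free_group X)) (carrier (free_group X))"
    by (intro bij_betw_cong free_ext_gens)
  then show ?thesis
    by (auto simp: basis_family_def bij_betw_def)
qed

text \<open>If \<open>g\<close> and \<open>h\<close> express the generators of two free groups through each other, then they induce
mutually inverse isomorphisms, and a basis composed with an isomorphism is a basis. Renaming of
indices and both kinds of Nielsen moves are instances.\<close>

lemma basis_family_transfer:
  assumes H: "group H" and f: "basis_family H I f"
    and g: "g \<in> J \<rightarrow> carrier (free_group I)" and h: "h \<in> I \<rightarrow> carrier (free_group J)"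
    and gh: "\<And>i. i \<in> I \<Longrightarrow> free_ext (free_group I) g (h i) = free_gen i"
    and hg: "\<And>j. j \<in> J \<Longrightarrow> free_ext (free_group J) h (g j) = free_gen j"
    and f': "\<And>j. j \<in> J \<Longrightarrow> f' j = free_ext H f (g j)"
  shows "basis_family H J f'"
proof -
  let ?g = "free_ext (free_group I) g" and ?h = "free_ext (free_group J) h"
  have fI: "f \<in> I \<rightarrow> carrier H" using f by (simp add: basis_family_def)
  have f_hom: "free_ext H f \<in> hom (free_group I) H"
    using H fI by (rule group.free_ext_hom)
  have g_hom: "?g \<in> hom (free_group J) (free_group I)"
    using g by (rule group.free_ext_hom[OF group_free_group])
  have h_hom: "?h \<in> hom (free_group I) (free_group J)"
    using h by (rule group.free_ext_hom[OF group_free_group])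
  have 1: "?g (?h w) = w" if w: "w \<in> carrier (free_group I)" for w
  proof -
    have "?g (?h w) = free_ext (free_group I) (\<lambda>i. ?g (h i)) w"
      by (rule hom_free_ext[OF group_free_group group_free_group g_hom h w])
    also have "\<dots> = free_ext (free_group I) free_gen w"
      using w by (intro free_ext_cong gh) (auto simp: free_group_def)
    finally show ?thesis using free_ext_gens[OF w] by simp
  qed
  have 2: "?h (?g w) = w" if w: "w \<in> carrier (free_group J)" for w
  proof -
    have "?h (?g w) = free_ext (free_group J) (\<lambda>i. ?h (g i)) w"
      by (rule hom_free_ext[OF group_free_group group_free_group h_hom g w])
    also have "\<dots> = free_ext (free_group J) free_gen w"
      using w by (intro free_ext_cong hg) (auto simp: free_group_def)
    finally show ?thesis using free_ext_gens[OF w] by simp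
  qed
  have 3: "free_ext H f' w = (free_ext H f \<circ> ?g) w" if w: "w \<in> carrier (free_group J)" for w
  proof -
    have "free_ext H f (?g w) = free_ext H (\<lambda>j. free_ext H f (g j)) w"
      by (rule hom_free_ext[OF group_free_group H f_hom g w])
    also have "\<dots> = free_ext H f' w"
      using w by (intro free_ext_cong) (auto simp: free_group_def f')
    finally show ?thesis by simp
  qed
  have "bij_betw ?g (carrier (free_group J)) (carrier (free_group I))"
    using 1 2 g_hom h_hom by (intro bij_betw_byWitness[where f' = ?h]) (auto simp: hom_def)
  then have "bij_betw (free_ext H f \<circ> ?g) (carrier (free_group J)) (carrier H)"
    using f by (auto simp: basis_family_def intro: bij_betw_trans)
  moreover have "f' \<in> J \<rightarrow> carrier H"
    using f_hom g by (auto simp: f' hom_def)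
  ultimately show ?thesis
    using 3 by (simp add: basis_family_def cong: bij_betw_cong)
qed

lemma basis_family_reindex:
  assumes "group H" "basis_family H I f" "bij_betw p J I"
  shows "basis_family H J (\<lambda>j. f (p j))"
proof (rule basis_family_transfer[OF assms(1,2),
      where g = "\<lambda>j. free_gen (p j)" and h = "\<lambda>i. free_gen (inv_into J p i)"])
  have p: "p ` J = I" "\<And>j. j \<in> J \<Longrightarrow> p j \<in> I" using assms(3) by (auto simp: bij_betw_def)
  have p': "inv_into J p i \<in> J" if "i \<in> I" for i
    using p that by (metis inv_into_into)
  show "f (p j) = free_ext H f (free_gen (p j))" if "j \<in> J" for j
    using assms(1,2) p(2)[OF that] by (auto simp: basis_family_def group.free_ext_free_gen Pi_iff)
  show "free_ext (free_group I) (\<lambda>j. free_gen (p j)) (free_gen (inv_into J p i)) = free_gen i"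
    if "i \<in> I" for i
    using that p(1) by (simp add: group.free_ext_free_gen[OF group_free_group] f_inv_into_f)
  show "free_ext (free_group J) (\<lambda>i. free_gen (inv_into J p i)) (free_gen (p j)) = free_gen j"
    if "j \<in> J" for j
    using that assms(3) by (simp add: group.free_ext_free_gen[OF group_free_group] bij_betw_inv_into_left)
  show "(\<lambda>j. free_gen (p j)) \<in> J \<rightarrow> carrier (free_group I)"
    "(\<lambda>i. free_gen (inv_into J p i)) \<in> I \<rightarrow> carrier (free_group J)"
    using p(2) p' by auto
qed

lemma basis_family_letter_inj:
  assumes "group H" "basis_family H I f" "i \<in> I" "j \<in> I"
    and "free_ext H f [(i, b)] = free_ext H f [(j, c)]"
  shows "i = j \<and> b = c"
  using assms inj_onD[of "free_ext H f" "carrier (free_group I)" "[(i, b)]" "[(j, c)]"]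
  by (simp add: basis_family_def bij_betw_def)

lemma free_basis_image:
  assumes "group H" "basis_family H I f"
  shows "free_basis H (f ` I)"
proof -
  have f: "f i \<in> carrier H" if "i \<in> I" for i
    using assms that by (auto simp: basis_family_def)
  have "inj_on f I"
  proof (rule inj_onI)
    fix i j assume "i \<in> I" "j \<in> I" "f i = f j"
    then show "i = j" using basis_family_letter_inj[OF assms, of i j True True] by simp
  qed
  then have *: "bij_betw (inv_into I f) (f ` I) I"
    by (rule inj_on_imp_bij_betw [THEN bij_betw_inv_into])
  have "basis_family H (f ` I) (\<lambda>j. f (inv_into I f j))"
    by (rule basis_family_reindex[OF assms *])
  then have "basis_family H (f ` I) (\<lambda>j. j)"
    by (rule basis_family_transfer[OF assms(1), where g = free_gen and h = free_gen])
      (auto simp: group.free_ext_free_gen[OF assms(1)] group.free_ext_free_gen[OF group_free_group] f f_inv_into_f inv_into_into)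
  then show ?thesis by (simp add: free_basis_iff_basis_family)
qed

text \<open>No proper part of a basis generates: a further basis element would be a word in that part as well
as a one-letter word, against the uniqueness of its expression.\<close>

lemma basis_family_generating_subset:
  assumes f: "basis_family (free_group X) I f" and "I0 \<subseteq> I"
    and gen: "\<And>x. x \<in> X \<Longrightarrow> \<exists>w \<in> carrier (free_group I0). free_ext (free_group X) f w = free_gen x"
  shows "I0 = I"
proof (intro equalityI assms subsetI)
  fix i assume i: "i \<in> I"
  have fI: "f \<in> I \<rightarrow> carrier (free_group X)" using f by (simp add: basis_family_def)
  then have fI0: "f \<in> I0 \<rightarrow> carrier (free_group X)" using assms(2) by blast
  obtain r where r: "\<And>x. x \<in> X \<Longrightarrow> r x \<in> carrier (free_group I0)"
    "\<And>x. x \<in> X \<Longrightarrow> free_ext (free_group X) f (r x) = free_gen x"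
    using gen by metis
  have y: "f i \<in> carrier (free_group X)" using fI i by auto
  define w where "w = free_ext (free_group I0) r (f i)"
  have w0: "w \<in> carrier (free_group I0)"
    using r(1) y unfolding w_def
    by (intro group.free_ext_closed[OF group_free_group, of r X]) (auto simp: free_group_def)
  have "free_ext (free_group X) f w = free_ext (free_group X) (\<lambda>x. free_ext (free_group X) f (r x)) (f i)"
    unfolding w_def using r(1) y
    by (intro hom_free_ext[OF group_free_group group_free_group] group.free_ext_hom group_free_group fI0) auto
  also have "\<dots> = free_ext (free_group X) free_gen (f i)"
    using y by (intro free_ext_cong r) (auto simp: free_group_def)
  also have "\<dots> = f i" by (rule free_ext_gens[OF y])
  also have "\<dots> = free_ext (free_group X) f [(i, True)]"
    using y by (simp add: monoid.r_one group_free_group group.is_monoid)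
  finally have "w = [(i, True)]"
    using f w0 i assms(2)
    by (auto simp: basis_family_def bij_betw_def free_group_def reduced_Cons elim!: inj_onD)
  then show "i \<in> I0" using w0 by simp
qed

section \<open>Nielsen moves\<close>

text \<open>Only the values on \<open>I\<close> matter, so a move prescribes the new function on \<open>I\<close> alone.\<close>

inductive nielsen :: "('a, 'b) monoid_scheme \<Rightarrow> 'i set \<Rightarrow> ('i \<Rightarrow> 'a) \<Rightarrow> ('i \<Rightarrow> 'a) \<Rightarrow> bool"
  for H I f where
  nielsen_refl: "\<forall>k\<in>I. g k = f k \<Longrightarrow> nielsen H I f g"
| nielsen_inv: "nielsen H I f g \<Longrightarrow> i \<in> I \<Longrightarrow> \<forall>k\<in>I - {i}. g' k = g k \<Longrightarrow> g' i = inv\<^bsub>H\<^esub> g i \<Longrightarrow>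
    nielsen H I f g'"
| nielsen_mult: "nielsen H I f g \<Longrightarrow> i \<in> I \<Longrightarrow> j \<in> I \<Longrightarrow> j \<noteq> i \<Longrightarrow> \<forall>k\<in>I - {i}. g' k = g k \<Longrightarrow>
    g' i = g i \<otimes>\<^bsub>H\<^esub> g j \<Longrightarrow> nielsen H I f g'"

lemma nielsen_trans: "nielsen H I g h \<Longrightarrow> nielsen H I f g \<Longrightarrow> nielsen H I f h"
proof (induction rule: nielsen.induct)
  case (nielsen_refl h)
  from nielsen_refl(2) show ?case
  proof cases
    case nielsen_refl': nielsen_refl
    with nielsen_refl(1) show ?thesis by (intro nielsen.nielsen_refl) simp
  next
    case (nielsen_inv g' i)
    with nielsen_refl(1) show ?thesis by (intro nielsen.nielsen_inv[of H I f g' i h]) auto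
  next
    case (nielsen_mult g' i j)
    with nielsen_refl(1) show ?thesis by (intro nielsen.nielsen_mult[of H I f g' i j h]) auto
  qed
qed (blast intro: nielsen.intros)+

context group
begin

lemma nielsen_closed: "nielsen G I f g \<Longrightarrow> f \<in> I \<rightarrow> carrier G \<Longrightarrow> g \<in> I \<rightarrow> carrier G"
proof (induction rule: nielsen.induct)
  case (nielsen_inv g i g')
  show ?case
  proof
    fix k assume "k \<in> I" then show "g' k \<in> carrier G"
      using nielsen_inv by (cases "k = i") (auto simp: Pi_iff)
  qed
next
  case (nielsen_mult g i j g')
  show ?case
  proof
    fix k assume "k \<in> I" then show "g' k \<in> carrier G"
      using nielsen_mult by (cases "k = i") (auto simp: Pi_iff)
  qed
qed (simp add: Pi_iff)

lemma nielsen_mult_inv: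
  assumes "nielsen G I f g" "f \<in> I \<rightarrow> carrier G" "i \<in> I" "j \<in> I" "j \<noteq> i"
    and "\<forall>k\<in>I - {i}. g' k = g k" "g' i = g i \<otimes> inv (g j)"
  shows "nielsen G I f g'"
proof -
  have g: "g j \<in> carrier G" using nielsen_closed[OF assms(1,2)] assms(4) by auto
  let ?g1 = "g(j := inv (g j))"
  let ?g2 = "?g1(i := g i \<otimes> inv (g j))"
  have 1: "nielsen G I f ?g1"
    by (rule nielsen_inv[OF assms(1), of j]) (use assms in auto)
  have 2: "nielsen G I f ?g2"
    by (rule nielsen_mult[OF 1, of i j]) (use assms in auto)
  show ?thesis
    by (rule nielsen_inv[OF 2, of j]) (use assms g in auto)
qed

text \<open>Moves can be undone: division by another component is a multiplication between two inversions of
that component.\<close>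

lemma nielsen_sym: "nielsen G I f g \<Longrightarrow> f \<in> I \<rightarrow> carrier G \<Longrightarrow> nielsen G I g f"
proof (induction rule: nielsen.induct)
  case (nielsen_refl g)
  then show ?case by (intro nielsen.nielsen_refl) simp
next
  case (nielsen_inv g i g')
  have g: "g i \<in> carrier G" using nielsen_closed[OF nielsen_inv.hyps(1)] nielsen_inv by auto
  have "nielsen G I g' g"
    by (rule nielsen.nielsen_inv[of G I g' g' i g])
      (use nielsen_inv g in \<open>auto intro: nielsen.nielsen_refl\<close>)
  then show ?case using nielsen_inv by (blast intro: nielsen_trans)
next
  case (nielsen_mult g i j g')
  have g: "g \<in> I \<rightarrow> carrier G" using nielsen_closed[OF nielsen_mult.hyps(1)] nielsen_mult by auto
  then have "g' \<in> I \<rightarrow> carrier G"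
    using nielsen_closed[OF nielsen.nielsen_mult[OF nielsen_mult.hyps]] nielsen_mult.prems by blast
  then have "nielsen G I g' g"
    by (rule nielsen_mult_inv[of I g' g' i j g, rotated])
      (use nielsen_mult g in \<open>auto simp: Pi_iff m_assoc intro: nielsen.nielsen_refl\<close>)
  then show ?case using nielsen_mult by (blast intro: nielsen_trans)
qed

text \<open>Multiplication from the left and by inverses is covered too, up to inverting the
result; lengths and weights of words do not see that inversion.\<close>

lemma nielsen_mult_signed:
  assumes "nielsen G I f g" "f \<in> I \<rightarrow> carrier G" "i \<in> I" "j \<in> I" "j \<noteq> i"
    and s: "s \<in> {g i, inv (g i)}" and t: "t \<in> {g j, inv (g j)}"
  shows "\<exists>y \<in> {s \<otimes> t, inv (s \<otimes> t)}. nielsen G I f (g(i := y))"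
proof -
  have g: "g i \<in> carrier G" "g j \<in> carrier G"
    using nielsen_closed[OF assms(1,2)] assms(3,4) by auto
  then have st: "s \<in> carrier G" "t \<in> carrier G" using s t by auto
  have *: "nielsen G I f (g(i := s))"
    using s
  proof (elim insertE emptyE)
    assume "s = inv (g i)"
    then show ?thesis using nielsen_inv[OF assms(1,3), of "g(i := s)"] by simp
  qed (simp add: assms(1))
  show ?thesis
  proof (cases "t = g j")
    case True
    then show ?thesis
      using nielsen_mult[OF * assms(3,4,5), of "g(i := s \<otimes> t)"] assms(5) by auto
  next
    case False
    then have "t = inv (g j)" using t by simp
    then show ?thesis
      using nielsen_mult_inv[OF * assms(2-5), of "g(i := s \<otimes> t)"] assms(5) by auto
  qed
qed

end

lemma nielsen_reindex:
  assumes "nielsen H I f g" "bij_betw p J I"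
  shows "nielsen H J (\<lambda>j. f (p j)) (\<lambda>j. g (p j))"
  using assms(1)
proof (induction rule: nielsen.induct)
  case (nielsen_refl g)
  then show ?case using assms(2) by (intro nielsen.nielsen_refl) (auto simp: bij_betw_def)
next
  case (nielsen_inv g i g')
  obtain i' where i': "i' \<in> J" "i = p i'" using nielsen_inv assms(2) by (auto simp: bij_betw_def)
  have "p k \<in> I - {i}" if "k \<in> J - {i'}" for k
    using that assms(2) i' by (auto simp: bij_betw_def inj_on_def)
  then show ?case
    using nielsen_inv i' by (intro nielsen.nielsen_inv[OF nielsen_inv.IH, of i']) auto
next
  case (nielsen_mult g i j g')
  obtain i' where i': "i' \<in> J" "i = p i'" using nielsen_mult assms(2) by (auto simp: bij_betw_def)
  obtain j' where j': "j' \<in> J" "j = p j'" using nielsen_mult assms(2) by (auto simp: bij_betw_def)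
  have "p k \<in> I - {i}" if "k \<in> J - {i'}" for k
    using that assms(2) i' by (auto simp: bij_betw_def inj_on_def)
  then show ?case
    using nielsen_mult i' j' by (intro nielsen.nielsen_mult[OF nielsen_mult.IH, of i' j']) auto
qed

lemma nielsen_hom:
  assumes "group H" "group K" "h \<in> hom H K" "f \<in> I \<rightarrow> carrier H" "nielsen H I f g"
  shows "nielsen K I (\<lambda>i. h (f i)) (\<lambda>i. h (g i))"
proof -
  interpret group_hom H K h using assms by (simp add: group_hom_def group_hom_axioms_def)
  show ?thesis
    using assms(5)
  proof (induction rule: nielsen.induct)
    case (nielsen_refl g)
    then show ?case by (intro nielsen.nielsen_refl) simp
  next
    case (nielsen_inv g i g')
    have "g i \<in> carrier H" using G.nielsen_closed[OF nielsen_inv.hyps(1) assms(4)] nielsen_inv by auto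
    then show ?case using nielsen_inv by (intro nielsen.nielsen_inv[OF nielsen_inv.IH, of i]) auto
  next
    case (nielsen_mult g i j g')
    have "g i \<in> carrier H" "g j \<in> carrier H"
      using G.nielsen_closed[OF nielsen_mult.hyps(1) assms(4)] nielsen_mult by auto
    then show ?case using nielsen_mult by (intro nielsen.nielsen_mult[OF nielsen_mult.IH, of i j]) auto
  qed
qed

text \<open>Moves of the images lift to moves of the preimages, because a move is given by a group word.\<close>

lemma nielsen_lift:
  assumes "nielsen K I (\<lambda>i. h (f i)) t" "group H" "group K" "h \<in> hom H K" "f \<in> I \<rightarrow> carrier H"
  shows "\<exists>g. nielsen H I f g \<and> (\<forall>i\<in>I. t i = h (g i))"
  using assms(1)
proof (induction rule: nielsen.induct)
  case (nielsen_refl t)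
  then show ?case by (intro exI[of _ f]) (auto intro: nielsen.nielsen_refl)
next
  interpret group_hom H K h using assms by (simp add: group_hom_def group_hom_axioms_def)
  case (nielsen_inv t i t')
  then obtain g where g: "nielsen H I f g" "\<forall>i\<in>I. t i = h (g i)" by blast
  have "g i \<in> carrier H" using G.nielsen_closed[OF g(1) assms(5)] nielsen_inv by auto
  moreover have "nielsen H I f (g(i := inv\<^bsub>H\<^esub> g i))"
    using nielsen_inv by (intro nielsen.nielsen_inv[OF g(1), of i]) auto
  moreover from calculation have "\<forall>k\<in>I. t' k = h ((g(i := inv\<^bsub>H\<^esub> g i)) k)"
    using g nielsen_inv by simp
  ultimately show ?case by blast
next
  interpret group_hom H K h using assms by (simp add: group_hom_def group_hom_axioms_def)
  case (nielsen_mult t i j t')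
  then obtain g where g: "nielsen H I f g" "\<forall>i\<in>I. t i = h (g i)" by blast
  have "g i \<in> carrier H" "g j \<in> carrier H"
    using G.nielsen_closed[OF g(1) assms(5)] nielsen_mult by auto
  moreover have "nielsen H I f (g(i := g i \<otimes>\<^bsub>H\<^esub> g j))"
    using nielsen_mult by (intro nielsen.nielsen_mult[OF g(1), of i j]) auto
  moreover from calculation have "\<forall>k\<in>I. t' k = h ((g(i := g i \<otimes>\<^bsub>H\<^esub> g j)) k)"
    using g nielsen_mult by simp
  ultimately show ?case by blast
qed

text \<open>A move substitutes generators by words, and the opposite move gives the inverse substitution.\<close>

lemma basis_family_nielsen:
  assumes "nielsen H I f g" "group H" "basis_family H I f"
  shows "basis_family H I g"
  using assms(1)
proof (induction rule: nielsen.induct)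
  interpret F: group "free_group I" by (rule group_free_group)
  interpret H: group H by (rule assms)
  note free_ext_gen = F.free_ext_free_gen H.free_ext_free_gen
  {
    case (nielsen_refl g)
    show ?case
      by (rule basis_family_transfer[OF assms(2,3), where g = free_gen and h = free_gen])
        (use nielsen_refl assms in \<open>auto simp: free_ext_gen basis_family_def Pi_iff\<close>)
  next
    case (nielsen_inv g i g')
    let ?a = "\<lambda>k. if k = i then [(i, False)] else free_gen k"
    have g: "g \<in> I \<rightarrow> carrier H" using nielsen_inv.IH by (simp add: basis_family_def)
    have a: "?a \<in> I \<rightarrow> carrier (free_group I)" using nielsen_inv by auto
    have aa: "free_ext (free_group I) ?a (?a k) = free_gen k" if "k \<in> I" for k
      using that nielsen_inv.hyps(2)
      by (auto simp: free_ext_gen inv_letter_free_group free_gen_def one_free_group mult_free_group)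
    show ?case
      by (rule basis_family_transfer[OF assms(2) nielsen_inv.IH a a aa aa])
        (use nielsen_inv g in \<open>auto simp: free_ext_gen Pi_iff\<close>)
  next
    case (nielsen_mult g i j g')
    let ?a = "\<lambda>k. if k = i then [(i, True), (j, True)] else free_gen k"
    let ?b = "\<lambda>k. if k = i then [(i, True), (j, False)] else free_gen k"
    have g: "g \<in> I \<rightarrow> carrier H" using nielsen_mult.IH by (simp add: basis_family_def)
    have c: "?a \<in> I \<rightarrow> carrier (free_group I)" "?b \<in> I \<rightarrow> carrier (free_group I)"
      using nielsen_mult by (auto simp: free_group_def reduced_Cons inv_letter_def free_gen_def)
    have ab: "free_ext (free_group I) ?a (?b k) = free_gen k"
      "free_ext (free_group I) ?b (?a k) = free_gen k" if "k \<in> I" for k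
      using that nielsen_mult.hyps(2-4)
      by (auto simp: free_ext_gen inv_letter_free_group free_gen_def)
        (auto simp: free_group_def inv_letter_def)
    show ?case
      by (rule basis_family_transfer[OF assms(2) nielsen_mult.IH c(1) c(2) ab(1) ab(2)])
        (use nielsen_mult g in \<open>auto simp: free_ext_gen Pi_iff\<close>)
  }
qed

section \<open>Cancellation\<close>

abbreviation winv :: "('x \<times> bool) list \<Rightarrow> ('x \<times> bool) list" where
  "winv w \<equiv> rev (map inv_letter w)"

abbreviation wmult :: "('x \<times> bool) list \<Rightarrow> ('x \<times> bool) list \<Rightarrow> ('x \<times> bool) list"
    (infixr "\<odot>" 65) where
  "u \<odot> v \<equiv> foldr push u v"

lemma winv_winv: "winv (winv w) = w"
  by (simp add: rev_map[symmetric] comp_def)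

lemma reduced_append:
  "reduced (u @ v) \<longleftrightarrow> reduced u \<and> reduced v \<and>
     (u = [] \<or> v = [] \<or> hd v \<noteq> inv_letter (last u))"
  by (auto simp: reduced_def successively_append_iff)

lemma reduced_winv: "reduced (winv w) \<longleftrightarrow> reduced w"
proof -
  have *: "reduced (winv w)" if "reduced w" for w :: "('x \<times> bool) list"
    using that inv_free_group[of w UNIV]
      group.inv_closed[OF group_free_group, of w UNIV]
    by (simp add: free_group_def)
  show ?thesis using *[of w] *[of "winv w"] by (auto simp: winv_winv)
qed

lemma wmult_reduced: "reduced (u @ v) \<Longrightarrow> u \<odot> v = u @ v"
proof (induction u)
  case (Cons a u)
  then show ?case using push_reduced[of a "u @ v"] by (simp add: reduced_Cons)
qed simp

lemma winv_wmult:
  assumes "reduced u" "reduced v"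
  shows "winv (u \<odot> v) = winv v \<odot> winv u"
proof -
  interpret F: group "free_group (UNIV :: 'a set)" by (rule group_free_group)
  have uv: "u \<in> carrier (free_group UNIV)" "v \<in> carrier (free_group UNIV)"
    using assms by (auto simp: free_group_def)
  show ?thesis
    using F.inv_mult_group[OF uv] F.m_closed[OF uv] uv
    by (simp add: inv_free_group mult_free_group)
qed

text \<open>Comparing both ends of such a word, one strips letters in inverse pairs until two adjacent letters
are inverse to each other.\<close>

lemma reduced_eq_winv_imp_Nil: "reduced p \<Longrightarrow> winv p = p \<Longrightarrow> p = []"
proof (induction "length p" arbitrary: p rule: less_induct)
  case less
  show ?case
  proof (rule ccontr)
    assume "p \<noteq> []"
    then obtain a r where p: "p = a # r" by (cases p) auto
    have "r \<noteq> []" using less.prems(2) p by auto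
    then obtain m b where r: "r = m @ [b]" by (cases r rule: rev_cases) auto
    have b: "b = inv_letter a" and m: "winv m = m" using less.prems(2) p r by auto
    have "reduced m" using less.prems(1) p r by (simp add: reduced_Cons reduced_append)
    then have "m = []" using less.hyps[of m] m p r by simp
    then show False using less.prems(1) p r b by (simp add: reduced_Cons)
  qed
qed

lemma cancellation:
  assumes "reduced u" "reduced v"
  shows "\<exists>A P B. u = A @ winv P \<and> v = P @ B \<and> u \<odot> v = A @ B"
  using assms(1)
proof (induction u)
  case (Cons a u)
  then obtain A P B where u: "u = A @ winv P" and v: "v = P @ B" and uv: "u \<odot> v = A @ B"
    by (auto simp: reduced_Cons)
  show ?case
  proof (cases A)
    case A: Nil
    show ?thesis
    proof (cases "B \<noteq> [] \<and> hd B = inv_letter a")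
      case True
      then obtain B' where B: "B = inv_letter a # B'" by (cases B) auto
      then show ?thesis
        using u v uv A by (intro exI[of _ "[]"] exI[of _ "P @ [inv_letter a]"] exI[of _ B']) simp
    next
      case False
      then show ?thesis
        using u v uv A by (intro exI[of _ "[a]"] exI[of _ P] exI[of _ B]) (cases B; simp)
    qed
  next
    case (Cons a' A')
    then have "a' \<noteq> inv_letter a" using Cons.prems u by (simp add: reduced_Cons)
    then show ?thesis
      using u v uv Cons by (intro exI[of _ "a # A"] exI[of _ P] exI[of _ B]) simp
  qed
qed (auto intro: exI[of _ "[]"])

text \<open>The number of letters of \<open>u\<close> that cancel in the product of the reduced words \<open>u\<close> and \<open>v\<close>. They cancel
against as many letters of \<open>v\<close>, hence the division by two.\<close>

definition canc :: "('x \<times> bool) list \<Rightarrow> ('x \<times> bool) list \<Rightarrow> nat" where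
  "canc u v = (length u + length v - length (u \<odot> v)) div 2"

lemma cancE:
  assumes "reduced u" "reduced v"
  obtains A P B where "u = A @ winv P" "v = P @ B" "u \<odot> v = A @ B" "length P = canc u v"
proof -
  obtain A P B where *: "u = A @ winv P" "v = P @ B" "u \<odot> v = A @ B"
    using cancellation[OF assms] by blast
  then have "length P = canc u v" by (simp add: canc_def)
  with * show ?thesis using that by blast
qed

lemma length_wmult:
  assumes "reduced u" "reduced v"
  shows "length (u \<odot> v) + 2 * canc u v = length u + length v"
proof -
  obtain A P B where *: "u = A @ winv P" "v = P @ B" "u \<odot> v = A @ B" "length P = canc u v"
    by (rule cancE[OF assms])
  have "length u = length A + canc u v" "length v = canc u v + length B"
    "length (u \<odot> v) = length A + length B"
    using *(1,2,3)[THEN arg_cong, of length] *(4) by simp_all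
  then show ?thesis by simp
qed

text \<open>If at least half of \<open>u\<close> cancelled in \<open>u \<odot> u\<close>, then the middle part of \<open>u\<close> would equal its own inverse.\<close>

lemma canc_self:
  assumes "reduced u" "u \<noteq> []"
  shows "2 * canc u u < length u"
proof (rule ccontr)
  assume "\<not> 2 * canc u u < length u"
  then have less: "length u \<le> 2 * canc u u" by simp
  obtain A P B where u: "u = A @ winv P" "u = P @ B" and P: "length P = canc u u"
    by (rule cancE[OF assms(1,1)])
  have "length u = length A + length P" using arg_cong[OF u(1), of length] by simp
  then have "length A \<le> length P" using less P by linarith
  then have "take (length A) P = take (length A) u" by (simp add: u(2))
  also have "\<dots> = A" by (simp add: u(1))
  finally have "take (length A) P = A" .
  then obtain R where P: "P = A @ R" by (metis append_take_drop_id)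
  have "A @ winv R @ winv A = A @ R @ B"
    using u(1)[symmetric] u(2) unfolding P by (simp del: append_eq_append_conv)
  then have "winv R @ winv A = R @ B" by simp
  then have "winv R = R" by (simp add: append_eq_append_conv)
  moreover have "reduced R" using assms(1) u(2) P by (simp add: reduced_append)
  ultimately have "R = []" using reduced_eq_winv_imp_Nil by blast
  then have "u = A @ winv A" using u(1) P by simp
  then have "winv u = u" by (simp add: winv_winv)
  then show False using assms reduced_eq_winv_imp_Nil by blast
qed

section \<open>Nielsen reduced sets\<close>

text \<open>For a set closed under inverses: no factor loses more than one half against one
neighbour, and between two neighbours every factor retains a letter.\<close>

definition nielsen_reduced :: "('x \<times> bool) list set \<Rightarrow> bool" where
  "nielsen_reduced S \<longleftrightarrow> [] \<notin> S \<and> S \<subseteq> Collect reduced \<and>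
    (\<forall>u\<in>S. \<forall>v\<in>S. v \<noteq> winv u \<longrightarrow> 2 * canc u v \<le> length u \<and> 2 * canc u v \<le> length v) \<and>
    (\<forall>u\<in>S. \<forall>v\<in>S. \<forall>w\<in>S. v \<noteq> winv u \<longrightarrow> w \<noteq> winv v \<longrightarrow> canc u v + canc v w < length v)"

lemma nielsen_reducedD:
  assumes "nielsen_reduced S"
  shows "u \<in> S \<Longrightarrow> u \<noteq> [] \<and> reduced u"
    and "u \<in> S \<Longrightarrow> v \<in> S \<Longrightarrow> v \<noteq> winv u \<Longrightarrow> 2 * canc u v \<le> length u \<and> 2 * canc u v \<le> length v"
    and "u \<in> S \<Longrightarrow> v \<in> S \<Longrightarrow> w \<in> S \<Longrightarrow> v \<noteq> winv u \<Longrightarrow> w \<noteq> winv v \<Longrightarrow>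
      canc u v + canc v w < length v"
  using assms unfolding nielsen_reduced_def by blast+

text \<open>The induction keeps track of the first factor \<open>v\<close>: it survives except for the \<open>c\<close> letters lost against
its right neighbour, and any left neighbour \<open>u\<close> still leaves a letter of it. So multiplying
by \<open>u\<close> only cancels within \<open>v\<close>, exactly as in \<open>u \<odot> v\<close>.\<close>

lemma nielsen_reduced_product:
  assumes S: "nielsen_reduced S"
    and "set (v # vs) \<subseteq> S" "successively (\<lambda>u v. v \<noteq> winv u) (v # vs)"
  shows "\<exists>c R. foldr wmult (v # vs) [] = take (length v - c) v @ R \<and> length vs \<le> length R \<and>
    c < length v \<and> (\<forall>u\<in>S. v \<noteq> winv u \<longrightarrow> canc u v + c < length v)"
  using assms(2,3)
proof (induction vs arbitrary: v)
  case Nil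
  have v: "v \<in> S" "reduced v" "v \<noteq> []" using nielsen_reducedD(1)[OF S] Nil by auto
  have "canc u v < length v" if "u \<in> S" "v \<noteq> winv u" for u
    using nielsen_reducedD(2)[OF S that(1) v(1) that(2)] v(3) by (simp flip: length_greater_0_conv)
  with v show ?case by (intro exI[of _ 0] exI[of _ "[]"]) (auto simp: foldr_push_Nil)
next
  case (Cons v vs u)
  let ?W = "foldr wmult (v # vs) []"
  have uv: "u \<in> S" "v \<in> S" "v \<noteq> winv u" and red: "reduced u" "reduced v"
    using nielsen_reducedD(1)[OF S] Cons.prems by auto
  obtain c R where W: "?W = take (length v - c) v @ R" and R: "length vs \<le> length R"
    and "\<And>u. u \<in> S \<Longrightarrow> v \<noteq> winv u \<Longrightarrow> canc u v + c < length v"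
    using Cons.IH[of v] Cons.prems unfolding successively.simps(3) by (auto simp del: foldr.simps)
  with uv have c: "canc u v + c < length v" by blast
  obtain A P B where ABP: "u = A @ winv P" "v = P @ B" "u \<odot> v = A @ B" "length P = canc u v"
    by (rule cancE[OF red])
  define B1 where "B1 = take (length v - c - length P) B"
  have B1: "B1 \<noteq> []" "take (length v - c) v = P @ B1"
    using c ABP(2,4) arg_cong[OF ABP(2), of length] by (auto simp: B1_def)
  have "reduced ?W"
  proof -
    have "reduced (foldr wmult ws [])" for ws :: "('a \<times> bool) list list"
      by (induction ws) (auto simp: reduced_foldr_push)
    then show ?thesis .
  qed
  then have W_red: "reduced (P @ B1 @ R)" unfolding W B1(2) by simp
  have "reduced (A @ B)"
    using reduced_foldr_push[OF red(2), of u] unfolding ABP(3) .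
  then have "reduced (A @ B1)"
    by (metis B1_def append.assoc append_take_drop_id reduced_append)
  with W_red B1(1) have A_red: "reduced (A @ B1 @ R)"
    by (auto simp: reduced_append)
  have "u \<odot> ?W = A \<odot> (winv P \<odot> (P \<odot> (B1 @ R)))"
    using W_red unfolding W B1(2) by (subst ABP(1)) (simp add: wmult_reduced)
  also have "\<dots> = A \<odot> (B1 @ R)"
    using W_red by (subst foldr_push_snoc_inverse) (auto simp: reduced_append)
  also have "\<dots> = A @ B1 @ R"
    by (rule wmult_reduced[OF A_red])
  finally have prod: "foldr wmult (u # v # vs) [] = take (length u - length P) u @ (B1 @ R)"
    using arg_cong[OF ABP(1), of "take (length A)"] arg_cong[OF ABP(1), of length] by simp
  have "length B1 \<ge> 1" using B1(1) by (cases B1) auto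
  then have len: "length (v # vs) \<le> length (B1 @ R)" using R by simp
  have cond: "canc x u + length P < length u" if "x \<in> S" "u \<noteq> winv x" for x
    using nielsen_reducedD(3)[OF S that(1) uv(1,2) that(2) uv(3)] by (simp add: ABP(4))
  have "2 * canc u v \<le> length u" "u \<noteq> []"
    using nielsen_reducedD(1)[OF S uv(1)] nielsen_reducedD(2)[OF S uv] by simp_all
  then have "length P < length u" by (simp add: ABP(4) flip: length_greater_0_conv)
  with prod len cond show ?case by blast
qed

lemma length_nielsen_reduced_product:
  assumes "nielsen_reduced S" "set vs \<subseteq> S" "successively (\<lambda>u v. v \<noteq> winv u) vs"
  shows "length vs \<le> length (foldr wmult vs [])"
proof (cases vs)
  case (Cons v vs')
  then show ?thesis 
    using nielsen_reduced_product[OF assms(1), of v vs'] assms(2,3) by fastforce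
qed simp

section \<open>Weights of words\<close>

text \<open>A word read as a number in base \<open>K\<close>, whose digits \<open>2 * x\<close> and \<open>2 * x + 1\<close> stand for the two letters
of \<open>x\<close>. For \<open>n\<close> generators and \<open>K = 2 * n\<close> it orders the words of equal length lexicographically.\<close>

fun numeric :: "nat \<Rightarrow> (nat \<times> bool) list \<Rightarrow> nat" where
  "numeric K [] = 0"
| "numeric K ((x, b) # w) = (2 * x + of_bool b) * K ^ length w + numeric K w"

lemma numeric_append: "numeric K (u @ v) = numeric K u * K ^ length v + numeric K v"
  by (induction u) (auto simp: algebra_simps power_add)

lemma numeric_less: "fst ` set w \<subseteq> {..<n} \<Longrightarrow> numeric (2 * n) w < (2 * n) ^ length w"
proof (induction w)
  case (Cons a w)
  obtain x b where a: "a = (x, b)" by force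
  have "numeric (2 * n) (a # w) < (2 * x + of_bool b + 1) * (2 * n) ^ length w"
    using Cons by (simp add: a)
  also have "\<dots> \<le> (2 * n) * (2 * n) ^ length w"
    using Cons.prems by (intro mult_right_mono) (auto simp: a)
  finally show ?case by simp
qed simp

lemma numeric_inj:
  assumes "fst ` set u \<subseteq> {..<n}" "fst ` set v \<subseteq> {..<n}" "length u = length v"
    and "numeric (2 * n) u = numeric (2 * n) v"
  shows "u = v"
  using assms(3,1,2,4)
proof (induction u v rule: list_induct2)
  case (Cons a u b v)
  obtain x c y d where a: "a = (x, c)" "b = (y, d)" by (cases a; cases b) auto
  define M where "M = (2 * n) ^ length u"
  have less: "numeric (2 * n) u < M" "numeric (2 * n) v < M"
    using numeric_less[of u n] numeric_less[of v n] Cons by (auto simp: M_def)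
  have eq: "numeric (2 * n) u + (2 * x + of_bool c) * M = numeric (2 * n) v + (2 * y + of_bool d) * M"
    using Cons by (simp add: a M_def)
  have "numeric (2 * n) u = numeric (2 * n) v"
    using arg_cong[OF eq, of "\<lambda>z. z mod M"] less by simp
  moreover have "2 * x + of_bool c = 2 * y + (of_bool d :: nat)"
    using arg_cong[OF eq, of "\<lambda>z. z div M"] less by simp
  then have "x = y \<and> c = d" by (cases c; cases d) (simp; presburger)+
  ultimately show ?case using Cons by (simp add: a)
qed simp

text \<open>For odd length both halves include the middle letter. So replacing a prefix of at most half the
length of \<open>w\<close> by a smaller word of the same length lowers the first summand and does not touch the
second one.\<close>

definition half_weight :: "nat \<Rightarrow> (nat \<times> bool) list \<Rightarrow> nat" where
  "half_weight K w = (let h = (length w + 1) div 2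
     in numeric K (take h w) + numeric K (take h (winv w)))"

lemma half_weight_winv: "half_weight K (winv w) = half_weight K w"
  by (simp add: half_weight_def Let_def winv_winv)

lemma half_weight_prefix:
  assumes "length P = length Q" "length Q \<le> length C" "K > 0"
    and "half_weight K (Q @ C) \<le> half_weight K (P @ C)"
  shows "numeric K Q \<le> numeric K P"
proof -
  define h where "h = (length Q + length C + 1) div 2"
  have h: "length Q \<le> h" "h \<le> length C" using assms(2) by (auto simp: h_def)
  show ?thesis
    using assms(1,3,4) h by (auto simp: half_weight_def Let_def numeric_append simp flip: h_def)
qed

section \<open>Nielsen's theorem\<close>

lemma sum_fun_upd:
  fixes \<mu> :: "'a \<Rightarrow> nat"
  assumes "finite I" "i \<in> I"
  shows "(\<Sum>k\<in>I. \<mu> ((g(i := y)) k)) + \<mu> (g i) = (\<Sum>k\<in>I. \<mu> (g k)) + \<mu> y"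
proof -
  have "(\<Sum>k\<in>I - {i}. \<mu> ((g(i := y)) k)) = (\<Sum>k\<in>I - {i}. \<mu> (g k))"
    by (rule sum.cong) auto
  then show ?thesis using assms by (simp add: sum.remove)
qed

lemma winv_mem: "u \<in> {g, winv g} \<Longrightarrow> winv u \<in> {g, winv g}"
  by (auto simp: winv_winv)

text \<open>In terms of the changed component only: a move turns \<open>s\<close> into \<open>s \<odot> t\<close> up to inversion and fixes the
other components.\<close>

definition move_minimal :: "nat \<Rightarrow> 'i set \<Rightarrow> ('i \<Rightarrow> (nat \<times> bool) list) \<Rightarrow> bool" where
  "move_minimal K I g \<longleftrightarrow>
    (\<forall>i\<in>I. \<forall>j\<in>I. j \<noteq> i \<longrightarrow> (\<forall>s\<in>{g i, winv (g i)}. \<forall>t\<in>{g j, winv (g j)}.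
      length s \<le> length (s \<odot> t) \<and>
      (length (s \<odot> t) = length s \<longrightarrow> half_weight K s \<le> half_weight K (s \<odot> t))))"

text \<open>Minimise the total length and, among the tuples of that length, the total weight. A move changes only
one summand of each.\<close>

lemma ex_move_minimal:
  assumes I: "finite I" and f: "f \<in> I \<rightarrow> carrier (free_group X)"
  shows "\<exists>g. nielsen (free_group X) I f g \<and> move_minimal K I g"
proof -
  let ?F = "free_group X"
  interpret F: group ?F by (rule group_free_group)
  define L where "L g = (\<Sum>k\<in>I. length (g k))" for g :: "'a \<Rightarrow> (nat \<times> bool) list"
  define W where "W g = (\<Sum>k\<in>I. half_weight K (g k))" for g :: "'a \<Rightarrow> (nat \<times> bool) list"
  have "nielsen ?F I f f" by (simp add: nielsen_refl)
  then obtain g0 where g0: "nielsen ?F I f g0" "\<And>h. nielsen ?F I f h \<Longrightarrow> L g0 \<le> L h"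
    using ex_has_least_nat[of "nielsen ?F I f" f L] by blast
  then obtain g where g: "nielsen ?F I f g" "L g = L g0"
    and W_min: "\<And>h. nielsen ?F I f h \<Longrightarrow> L h = L g0 \<Longrightarrow> W g \<le> W h"
    using ex_has_least_nat[of "\<lambda>h. nielsen ?F I f h \<and> L h = L g0" g0 W] by auto
  have L_min: "L g \<le> L h" if "nielsen ?F I f h" for h using g0 g that by simp
  have "move_minimal K I g"
    unfolding move_minimal_def
  proof (intro ballI impI)
    fix i j s t
    assume i: "i \<in> I" and j: "j \<in> I" "j \<noteq> i"
      and s: "s \<in> {g i, winv (g i)}" and t: "t \<in> {g j, winv (g j)}"
    have gc: "g i \<in> carrier ?F" "g j \<in> carrier ?F"
      using F.nielsen_closed[OF g(1) f] i j by auto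
    then have st: "s \<in> carrier ?F" "t \<in> carrier ?F"
      using s t F.inv_closed inv_free_group by fastforce+
    then have "s \<odot> t \<in> carrier ?F" using F.m_closed by (simp add: mult_free_group)
    then obtain y where y: "y \<in> {s \<odot> t, winv (s \<odot> t)}" "nielsen ?F I f (g(i := y))"
      using F.nielsen_mult_signed[OF g(1) f i j, of s t] s t gc
      by (auto simp: inv_free_group mult_free_group)
    have L_eq: "L (g(i := y)) + length s = L g + length (s \<odot> t)"
      using sum_fun_upd[OF I i, of length g y] y(1) s by (auto simp: L_def)
    have W_eq: "W (g(i := y)) + half_weight K s = W g + half_weight K (s \<odot> t)"
      using sum_fun_upd[OF I i, of "half_weight K" g y] y(1) s
      by (auto simp: W_def half_weight_winv)
    show "length s \<le> length (s \<odot> t) \<and>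
      (length (s \<odot> t) = length s \<longrightarrow> half_weight K s \<le> half_weight K (s \<odot> t))"
      using L_min[OF y(2)] W_min[OF y(2)] L_eq W_eq g(2) by auto
  qed
  with g(1) show ?thesis by blast
qed

text \<open>Equal factors never cancel by one half, so the length condition concerns distinct components, where it is
minimality. If a factor \<open>v\<close> between \<open>u\<close> and \<open>w\<close> vanished, it would be \<open>P @ winv Q\<close> with halves of
equal length, \<open>w\<close> would start with \<open>Q\<close> and \<open>winv u\<close> with \<open>P\<close>. Multiplying \<open>w\<close> by \<open>v\<close> replaces the
prefix \<open>Q\<close> by \<open>P\<close>, and multiplying \<open>winv u\<close> by \<open>winv v\<close> replaces \<open>P\<close> by \<open>Q\<close>, both without change
of length. By minimality of the weight neither of \<open>P\<close> and \<open>Q\<close> is smaller than the other, so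
\<open>P = Q\<close> and \<open>v\<close> is trivial.\<close>

lemma nielsen_reduced_of_move_minimal:
  assumes g: "g \<in> I \<rightarrow> carrier (free_group {..<n})" and nontriv: "\<And>i. i \<in> I \<Longrightarrow> g i \<noteq> []"
    and minimal: "move_minimal (2 * n) I g"
  shows "nielsen_reduced (\<Union>i\<in>I. {g i, winv (g i)})"
proof -
  let ?S = "\<Union>i\<in>I. {g i, winv (g i)}"
  have min: "length s \<le> length (s \<odot> t) \<and>
      (length (s \<odot> t) = length s \<longrightarrow> half_weight (2 * n) s \<le> half_weight (2 * n) (s \<odot> t))"
    if "i \<in> I" "j \<in> I" "j \<noteq> i" "s \<in> {g i, winv (g i)}" "t \<in> {g j, winv (g j)}" for i j s t
    using minimal that unfolding move_minimal_def by blast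
  have S: "reduced u \<and> u \<noteq> [] \<and> fst ` set u \<subseteq> {..<n}" if u: "u \<in> ?S" for u
  proof -
    obtain i where i: "i \<in> I" "u \<in> {g i, winv (g i)}" using u by blast
    have "g i \<in> carrier (free_group {..<n})" using g i(1) by (rule funcset_mem)
    then have "reduced (g i) \<and> g i \<noteq> [] \<and> fst ` set (g i) \<subseteq> {..<n}"
      using nontriv[OF i(1)] by (simp add: free_group_def)
    then show ?thesis using i(2) by (auto simp: reduced_winv inv_letter_def image_subset_iff)
  qed
  have winv_S: "winv u \<in> ?S" if "u \<in> ?S" for u
  proof -
    obtain i where "i \<in> I" "u \<in> {g i, winv (g i)}" using \<open>u \<in> ?S\<close> by blast
    then show ?thesis by (intro UN_I[of i] winv_mem)
  qed
  have half_left: "2 * canc u v \<le> length v" if u: "u \<in> ?S" and v: "v \<in> ?S" "v \<noteq> winv u" for u v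
  proof -
    obtain i j where i: "i \<in> I" "u \<in> {g i, winv (g i)}" and j: "j \<in> I" "v \<in> {g j, winv (g j)}"
      using u v by blast
    show ?thesis
    proof (cases "i = j")
      case True
      then have "v = u" using i j v(2) by (auto simp: winv_winv)
      then show ?thesis using canc_self[of v] S[OF v(1)] by simp
    next
      case False
      then have "length u \<le> length (u \<odot> v)"
        using min[of i j u v] i j by blast
      then show ?thesis
        using length_wmult[of u v] S[OF u] S[OF v(1)] by linarith
    qed
  qed
  have canc_winv: "canc (winv v) (winv u) = canc u v" if "u \<in> ?S" "v \<in> ?S" for u v
  proof -
    have "length (winv v \<odot> winv u) = length (u \<odot> v)"
      using S[OF that(1)] S[OF that(2)] by (simp flip: winv_wmult)
    then show ?thesis by (simp add: canc_def add.commute)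
  qed
  have half_right: "2 * canc u v \<le> length u" if "u \<in> ?S" "v \<in> ?S" "v \<noteq> winv u" for u v
  proof -
    have "winv u \<noteq> winv (winv v)" using that(3) unfolding winv_winv by metis
    then have "2 * canc (winv v) (winv u) \<le> length (winv u)"
      by (rule half_left[OF winv_S[OF that(2)] winv_S[OF that(1)]])
    then show ?thesis by (simp add: canc_winv[OF that(1,2)])
  qed
  \<comment> \<open>Here \<open>w = Q @ C\<close> and \<open>v \<odot> w = P @ C\<close>. As \<open>w\<close> is the factor to be replaced, minimality is
      applied to \<open>winv w\<close>, which is multiplied from the right; weights agree on inverses.\<close>
  have heavy: "numeric (2 * n) Q \<le> numeric (2 * n) P"
    if v: "v \<in> ?S" and w: "w \<in> ?S" "w \<noteq> winv v" and len: "2 * canc v w = length v"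
      and PQ: "v = P @ winv Q" "length P = length Q"
    for v w P Q
  proof -
    obtain i j where i: "i \<in> I" "v \<in> {g i, winv (g i)}" and j: "j \<in> I" "w \<in> {g j, winv (g j)}"
      using v w by blast
    have "i \<noteq> j"
    proof
      assume "i = j"
      then have "w = v" using i j w(2) by (auto simp: winv_winv)
      then show False using canc_self[of v] S[OF v(1)] len by simp
    qed
    have red: "reduced v" "reduced w" using S[OF v] S[OF w(1)] by simp_all
    obtain A P' C where APC: "v = A @ winv P'" "w = P' @ C" "v \<odot> w = A @ C" "length P' = canc v w"
      by (rule cancE[OF red])
    have "length (winv P') = length (winv Q)"
      using arg_cong[OF PQ(1), of length] PQ(2) len APC(4) by simp
    then have AP: "A = P \<and> winv P' = winv Q"
      using APC(1) PQ(1) append_eq_append_conv[of "winv P'" "winv Q" A P] by simp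
    have "P' = Q"
      using arg_cong[OF conjunct2[OF AP], of "\<lambda>w. winv w"] unfolding winv_winv .
    note A = conjunct1[OF AP] this
    have w_eq: "w = Q @ C" and vw_eq: "v \<odot> w = P @ C" using APC(2,3) unfolding A by simp_all
    have lenC: "length Q \<le> length C"
      using half_right[OF v w] half_left[OF v w] APC(4) arg_cong[OF w_eq, of length] unfolding A by simp
    have prod: "winv w \<odot> winv v = winv (P @ C)"
      using winv_wmult[OF red] unfolding vw_eq by (rule sym)
    have "length (winv w \<odot> winv v) = length (winv w)"
      unfolding prod using PQ(2) arg_cong[OF w_eq, of length] by simp
    then have "half_weight (2 * n) (winv w) \<le> half_weight (2 * n) (winv w \<odot> winv v)"
      using min[OF j(1) i(1) \<open>i \<noteq> j\<close> winv_mem[OF j(2)] winv_mem[OF i(2)]] by blast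
    then have "half_weight (2 * n) (Q @ C) \<le> half_weight (2 * n) (P @ C)"
      unfolding prod half_weight_winv unfolding w_eq .
    moreover have "2 * n > 0"
    proof -
      have "fst (hd v) < n" using S[OF v] by (cases v) auto
      then show ?thesis by simp
    qed
    ultimately show ?thesis using half_weight_prefix[OF PQ(2) lenC] by blast
  qed
  have canc_sum: "canc u v + canc v w < length v"
    if u: "u \<in> ?S" and v: "v \<in> ?S" "v \<noteq> winv u" and w: "w \<in> ?S" "w \<noteq> winv v" for u v w
  proof (rule ccontr)
    assume "\<not> canc u v + canc v w < length v"
    then have eq: "2 * canc u v = length v" "2 * canc v w = length v"
      using half_left[OF u v] half_right[OF v(1) w] by linarith+
    have red: "reduced v" "reduced w" using S[OF v(1)] S[OF w(1)] by simp_all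
    obtain P Q C where *: "v = P @ winv Q" "w = Q @ C" "v \<odot> w = P @ C" "length Q = canc v w"
      by (rule cancE[OF red])
    have PQ: "v = P @ winv Q" "length P = length Q"
      using *(1,4) arg_cong[OF *(1), of length] eq(2) by simp_all
    have "numeric (2 * n) Q \<le> numeric (2 * n) P"
      by (rule heavy[OF v(1) w eq(2) PQ])
    moreover have "numeric (2 * n) P \<le> numeric (2 * n) Q"
    proof (rule heavy)
      show "winv v \<in> ?S" "winv u \<in> ?S" by (rule winv_S[OF v(1)], rule winv_S[OF u])
      show "winv u \<noteq> winv (winv v)" using v(2) unfolding winv_winv by metis
      show "2 * canc (winv v) (winv u) = length (winv v)"
        using canc_winv[OF u v(1)] eq by simp
      show "winv v = Q @ winv P" using PQ(1) winv_winv[of Q] by simp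
      show "length Q = length P" using PQ by simp
    qed
    moreover have "fst ` set (winv Q) = fst ` set Q"
      by (simp add: image_image inv_letter_def)
    then have "fst ` set P \<subseteq> {..<n}" "fst ` set Q \<subseteq> {..<n}"
      using S[OF v(1)] unfolding PQ(1) set_append image_Un by simp_all
    ultimately have "P = Q" using numeric_inj[of P n Q] PQ(2) by simp
    then have "winv v = v" unfolding PQ(1) by (simp add: winv_winv)
    then show False using reduced_eq_winv_imp_Nil S[OF v(1)] by blast
  qed
  show ?thesis
    unfolding nielsen_reduced_def
  proof (intro conjI ballI impI)
    show "[] \<notin> ?S"
    proof
      assume "[] \<in> ?S"
      from S[OF this] show False by simp
    qed
    show "?S \<subseteq> Collect reduced" by (rule subsetI, rule CollectI, rule conjunct1[OF S])
  qed (rule half_left half_right canc_sum; assumption)+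
qed

lemma free_ext_letter:
  assumes "g \<in> I \<rightarrow> carrier (free_group X)" "i \<in> I"
  shows "free_ext (free_group X) g [(i, b)] = (if b then g i else winv (g i))"
proof -
  interpret F: group "free_group X" by (rule group_free_group)
  have "g i \<in> carrier (free_group X)" using assms by auto
  then have "g i \<otimes>\<^bsub>free_group X\<^esub> \<one>\<^bsub>free_group X\<^esub> = g i"
    "inv\<^bsub>free_group X\<^esub> g i \<otimes>\<^bsub>free_group X\<^esub> \<one>\<^bsub>free_group X\<^esub> = winv (g i)"
    by (simp, subst F.r_one, simp, rule inv_free_group)
  then show ?thesis by (simp only: free_ext_Cons free_ext_Nil) simp
qed

lemma free_ext_free_group_product:
  assumes "g \<in> I \<rightarrow> carrier (free_group X)" "fst ` set w \<subseteq> I"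
  shows "free_ext (free_group X) g w = foldr wmult (map (\<lambda>a. free_ext (free_group X) g [a]) w) []"
  using assms(2)
proof (induction w)
  case (Cons a w)
  interpret F: group "free_group X" by (rule group_free_group)
  obtain i b where a: "a = (i, b)" by force
  have "g i \<in> carrier (free_group X)" using assms(1) Cons.prems a by auto
  then have "free_ext (free_group X) g (a # w) =
      free_ext (free_group X) g [a] \<otimes>\<^bsub>free_group X\<^esub> free_ext (free_group X) g w"
    by (simp add: a)
  then show ?case using Cons by (simp add: mult_free_group del: free_ext_Cons)
qed (simp add: one_free_group)

lemma nielsen_inv_subset:
  assumes "finite J" "J \<subseteq> I" "nielsen H I f g"
  shows "nielsen H I f (\<lambda>i. if i \<in> J then inv\<^bsub>H\<^esub> g i else g i)"
  using assms(1,2)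
proof (induction J rule: finite_induct)
  case (insert j J)
  then have "nielsen H I f (\<lambda>i. if i \<in> J then inv\<^bsub>H\<^esub> g i else g i)" by simp
  then show ?case by (rule nielsen_inv[of H I f _ j]) (use insert in auto)
qed (use assms(3) in simp)

text \<open>The total length is minimised over tuples in the class of \<open>f\<close>, and the minimal tuple \<open>g\<close> is again a
basis. Writing a generator of length one as a reduced product over \<open>g\<close> forces the product to have a
single factor. So the generators occur in \<open>g\<close> up to inversion, and since they generate, no
other index is left.\<close>

theorem nielsen_connects_bases:
  fixes f :: "'i \<Rightarrow> (nat \<times> bool) list"
  assumes I: "finite I" and f: "basis_family (free_group {..<n}) I f"
  shows "\<exists>\<sigma>. bij_betw \<sigma> I {..<n} \<and> nielsen (free_group {..<n}) I f (\<lambda>i. free_gen (\<sigma> i))"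
proof -
  let ?F = "free_group {..<n}"
  interpret F: group ?F by (rule group_free_group)
  have fI: "f \<in> I \<rightarrow> carrier ?F" using f by (simp add: basis_family_def)
  obtain g where g: "nielsen ?F I f g" and minimal: "move_minimal (2 * n) I g"
    using ex_move_minimal[OF I fI] by blast
  have basis: "basis_family ?F I g"
    by (rule basis_family_nielsen[OF g group_free_group f])
  then have gI: "g \<in> I \<rightarrow> carrier ?F" by (simp add: basis_family_def)
  note val = free_ext_letter[OF gI]
  have nontriv: "g i \<noteq> []" if i: "i \<in> I" for i
  proof
    assume "g i = []"
    then show False
      using basis_family_letter_inj[OF group_free_group basis i i, of True False] val[OF i]
      by (simp del: free_ext_Cons)
  qed
  have red: "nielsen_reduced (\<Union>i\<in>I. {g i, winv (g i)})"
    by (rule nielsen_reduced_of_move_minimal[OF gI nontriv minimal])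
  have "\<forall>x\<in>{..<n}. \<exists>a. fst a \<in> I \<and> free_ext ?F g [a] = free_gen x"
  proof
    fix x assume x: "x \<in> {..<n}"
    obtain w where w: "w \<in> carrier (free_group I)" "free_ext ?F g w = free_gen x"
    proof -
      have "free_gen x \<in> free_ext ?F g ` carrier (free_group I)"
        using basis x unfolding basis_family_def bij_betw_def by simp
      then show ?thesis using that by (metis imageE)
    qed
    let ?vs = "map (\<lambda>a. free_ext ?F g [a]) w"
    have wI: "fst ` set w \<subseteq> I" and w_red: "reduced w" using w by (auto simp: free_group_def)
    have "set ?vs \<subseteq> (\<Union>i\<in>I. {g i, winv (g i)})"
    proof
      fix v assume "v \<in> set ?vs"
      then obtain a where a: "a \<in> set w" "v = free_ext ?F g [a]" unfolding set_map by (rule imageE)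
      obtain i b where ib: "a = (i, b)" by (cases a)
      have i: "i \<in> I" using wI a(1) unfolding ib by force
      have "v \<in> {g i, winv (g i)}" unfolding a(2) ib val[OF i] by (cases b) simp_all
      then show "v \<in> (\<Union>i\<in>I. {g i, winv (g i)})" using i by blast
    qed
    moreover have "successively (\<lambda>u v. v \<noteq> winv u) ?vs"
      unfolding successively_map
    proof (rule successively_mono[OF w_red[unfolded reduced_def]])
      fix a b assume ab: "b \<noteq> inv_letter a" "a \<in> set w" "b \<in> set w"
      obtain i c j d where eq: "a = (i, c)" "b = (j, d)" by (cases a, cases b)
      have ij: "i \<in> I" "j \<in> I" using wI ab(2,3) unfolding eq by force+
      have winv_a: "winv (free_ext ?F g [a]) = free_ext ?F g [(i, \<not> c)]"
        unfolding eq val[OF ij(1)] by (cases c) (simp_all add: winv_winv)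
      show "free_ext ?F g [b] \<noteq> winv (free_ext ?F g [a])"
      proof
        assume "free_ext ?F g [b] = winv (free_ext ?F g [a])"
        then have "free_ext ?F g [(i, \<not> c)] = free_ext ?F g [(j, d)]"
          unfolding winv_a unfolding eq by (rule sym)
        then have "i = j \<and> (\<not> c) = d"
          by (rule basis_family_letter_inj[OF group_free_group basis ij])
        with ab(1) show False by (simp add: eq inv_letter_def)
      qed
    qed
    ultimately have "length ?vs \<le> length (foldr wmult ?vs [])"
      by (rule length_nielsen_reduced_product[OF red])
    then have "length w \<le> 1"
      unfolding free_ext_free_group_product[OF gI wI, symmetric] w(2) by (simp add: free_gen_def)
    moreover have "w \<noteq> []" using w(2) by (auto simp: free_gen_def one_free_group)
    ultimately obtain a where a: "w = [a]" by (cases w) auto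
    have "fst a \<in> I" using wI unfolding a by simp
    with w(2) show "\<exists>a. fst a \<in> I \<and> free_ext ?F g [a] = free_gen x" unfolding a by blast
  qed
  from bchoice[OF this] obtain \<alpha> where
    \<alpha>: "\<forall>x\<in>{..<n}. fst (\<alpha> x) \<in> I \<and> free_ext ?F g [\<alpha> x] = free_gen x" ..
  define \<tau> where "\<tau> x = fst (\<alpha> x)" for x
  define \<epsilon> where "\<epsilon> x = snd (\<alpha> x)" for x
  have \<tau>: "\<tau> x \<in> I" "free_ext ?F g [(\<tau> x, \<epsilon> x)] = free_gen x" if "x < n" for x
    using \<alpha> that by (simp_all add: \<tau>_def \<epsilon>_def del: free_ext_Cons)
  have "\<tau> ` {..<n} = I"
  proof (rule basis_family_generating_subset[OF basis])
    show "\<exists>w\<in>carrier (free_group (\<tau> ` {..<n})). free_ext ?F g w = free_gen x" if "x \<in> {..<n}" for x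
      using that \<tau>(2)[of x] by (intro bexI[of _ "[(\<tau> x, \<epsilon> x)]"]) (simp_all del: free_ext_Cons)
  qed (use \<tau>(1) in auto)
  moreover have "inj_on \<tau> {..<n}"
  proof (rule inj_onI)
    fix x y assume xy: "x \<in> {..<n}" "y \<in> {..<n}" "\<tau> x = \<tau> y"
    then have "(free_gen x :: (nat \<times> bool) list) \<in> {free_gen y, winv (free_gen y)}"
      using \<tau>(2)[of x] \<tau>(2)[of y] val[OF \<tau>(1), of x "\<epsilon> x"] val[OF \<tau>(1), of y "\<epsilon> y"]
      by (cases "\<epsilon> x"; cases "\<epsilon> y") (simp_all add: winv_winv del: free_ext_Cons)
    then show "x = y" by (simp add: free_gen_def inv_letter_def)
  qed
  ultimately have \<tau>_bij: "bij_betw \<tau> {..<n} I" by (simp add: bij_betw_def)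
  define \<sigma> where "\<sigma> = inv_into {..<n} \<tau>"
  have \<sigma>: "bij_betw \<sigma> I {..<n}" unfolding \<sigma>_def using \<tau>_bij by (rule bij_betw_inv_into)
  \<comment> \<open>\<open>g i\<close> is the generator \<open>\<sigma> i\<close> or its inverse; inversions at \<open>?J\<close> correct the signs.\<close>
  let ?J = "{i \<in> I. \<not> \<epsilon> (\<sigma> i)}"
  let ?g = "\<lambda>i. if i \<in> ?J then inv\<^bsub>?F\<^esub> g i else g i"
  have g': "nielsen ?F I f ?g"
    using I by (intro nielsen_inv_subset g) auto
  have "?g i = free_gen (\<sigma> i)" if i: "i \<in> I" for i
  proof -
    have "\<sigma> i < n" using \<sigma> i by (auto simp: bij_betw_def)
    moreover have "\<tau> (\<sigma> i) = i"
      using \<tau>_bij i by (auto simp: \<sigma>_def bij_betw_inv_into_right)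
    ultimately show ?thesis
      using \<tau>(2)[of "\<sigma> i"] val[OF i, of "\<epsilon> (\<sigma> i)"] i inv_free_group[of "g i" "{..<n}"] gI
      by (cases "\<epsilon> (\<sigma> i)") (simp_all add: Pi_iff del: free_ext_Cons)
  qed
  then have "nielsen ?F I ?g (\<lambda>i. free_gen (\<sigma> i))" by (intro nielsen_refl) simp
  then have "nielsen ?F I f (\<lambda>i. free_gen (\<sigma> i))" using g' by (rule nielsen_trans)
  with \<sigma> show ?thesis by blast
qed

text \<open>The finitely many generators involve finitely many elements of \<open>B\<close>, and these already generate.\<close>

lemma finite_free_basis:
  assumes X: "finite X" and B: "free_basis (free_group X) B"
  shows "finite B"
proof -
  have basis: "basis_family (free_group X) B (\<lambda>x. x)"
    using B by (simp add: free_basis_iff_basis_family)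
  have "\<forall>x\<in>X. \<exists>w. w \<in> carrier (free_group B) \<and> word_val (free_group X) w = free_gen x"
  proof
    fix x assume "x \<in> X"
    then have "free_gen x \<in> word_val (free_group X) ` carrier (free_group B)"
      using B unfolding free_basis_def bij_betw_def by simp
    then show "\<exists>w. w \<in> carrier (free_group B) \<and> word_val (free_group X) w = free_gen x"
      by (metis imageE)
  qed
  from bchoice[OF this] obtain r where
    "\<forall>x\<in>X. r x \<in> carrier (free_group B) \<and> word_val (free_group X) (r x) = free_gen x" ..
  then have r: "r x \<in> carrier (free_group B)" "word_val (free_group X) (r x) = free_gen x"
    if "x \<in> X" for x
    using that by simp_all
  let ?B0 = "\<Union>x\<in>X. fst ` set (r x)"
  have "?B0 = B"
  proof (rule basis_family_generating_subset[OF basis])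
    show "?B0 \<subseteq> B" using r(1) by (auto simp: free_group_def)
    fix x assume x: "x \<in> X"
    have "r x \<in> carrier (free_group ?B0)" using r(1)[OF x] x by (auto simp: free_group_def)
    then show "\<exists>w\<in>carrier (free_group ?B0). free_ext (free_group X) (\<lambda>x. x) w = free_gen x"
      using r(2)[OF x] by auto
  qed
  moreover have "finite ?B0" using X by simp
  ultimately show ?thesis by simp
qed

text \<open>A basis is joined to the standard basis in some order; using that order to renumber the basis by
\<open>{..<n}\<close> makes it a family that starts from the standard basis itself.\<close>

theorem primitive_iff_nielsen:
  fixes n :: nat
  shows "primitive (free_group {..<n}) x \<longleftrightarrow>
     (\<exists>g. nielsen (free_group {..<n}) {..<n} free_gen g \<and> x \<in> g ` {..<n})"
proof
  let ?F = "free_group {..<n}"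
  interpret F: group ?F by (rule group_free_group)
  assume "primitive ?F x"
  then obtain B where B: "free_basis ?F B" "x \<in> B" by (auto simp: primitive_def)
  have finB: "finite B" by (rule finite_free_basis[OF _ B(1)]) simp
  have basis: "basis_family ?F B (\<lambda>x. x)" using B by (simp add: free_basis_iff_basis_family)
  obtain \<sigma> where \<sigma>: "bij_betw \<sigma> B {..<n}" "nielsen ?F B (\<lambda>x. x) (\<lambda>i. free_gen (\<sigma> i))"
    using nielsen_connects_bases[OF finB basis] by blast
  have "nielsen ?F B (\<lambda>i. free_gen (\<sigma> i)) (\<lambda>x. x)"
    using F.nielsen_sym[OF \<sigma>(2)] basis by (simp add: basis_family_def)
  moreover have \<sigma>': "bij_betw (inv_into B \<sigma>) {..<n} B" using \<sigma>(1) by (rule bij_betw_inv_into)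
  ultimately have *: "nielsen ?F {..<n} (\<lambda>k. free_gen (\<sigma> (inv_into B \<sigma> k))) (inv_into B \<sigma>)"
    by (rule nielsen_reindex)
  have "nielsen ?F {..<n} free_gen (inv_into B \<sigma>)"
    by (rule nielsen_trans[OF *]) (use \<sigma>(1) in \<open>auto intro!: nielsen_refl simp: bij_betw_inv_into_right\<close>)
  moreover have "x \<in> inv_into B \<sigma> ` {..<n}"
    using \<sigma>' B(2) by (simp add: bij_betw_def)
  ultimately show "\<exists>g. nielsen ?F {..<n} free_gen g \<and> x \<in> g ` {..<n}"
    by (intro exI[of _ "inv_into B \<sigma>"] conjI)
next
  let ?F = "free_group {..<n}"
  assume "\<exists>g. nielsen ?F {..<n} free_gen g \<and> x \<in> g ` {..<n}"
  then obtain g where g: "nielsen ?F {..<n} free_gen g" and x: "x \<in> g ` {..<n}" by (elim exE conjE)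
  have "free_basis ?F (g ` {..<n})"
    by (intro free_basis_image basis_family_nielsen[OF g] basis_family_free_gen group_free_group)
  then show "primitive ?F x" using x unfolding primitive_def by (intro exI[of _ "g ` {..<n}"] conjI)
qed

lemma image_primitive_eq_nielsen:
  fixes n :: nat
  assumes "group G" "q \<in> hom (free_group {..<n}) G"
  shows "q ` {x. primitive (free_group {..<n}) x} =
    (\<Union>t\<in>Collect (nielsen G {..<n} (\<lambda>i. q (free_gen i))). t ` {..<n})"
proof (intro equalityI subsetI)
  have gen: "free_gen \<in> {..<n} \<rightarrow> carrier (free_group {..<n})" by simp
  {
    fix y assume "y \<in> q ` {x. primitive (free_group {..<n}) x}"
    then obtain x where x: "primitive (free_group {..<n}) x" "y = q x" by (elim imageE CollectE)
    from x(1) obtain g where g: "nielsen (free_group {..<n}) {..<n} free_gen g" "x \<in> g ` {..<n}"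
      unfolding primitive_iff_nielsen by (elim exE conjE)
    have "nielsen G {..<n} (\<lambda>i. q (free_gen i)) (\<lambda>i. q (g i))"
      by (rule nielsen_hom[OF group_free_group assms gen g(1)])
    moreover have "y \<in> (\<lambda>i. q (g i)) ` {..<n}" using g(2) x(2) by (elim imageE) simp
    ultimately show "y \<in> (\<Union>t\<in>Collect (nielsen G {..<n} (\<lambda>i. q (free_gen i))). t ` {..<n})"
      by (intro UN_I[of "\<lambda>i. q (g i)"] CollectI)
  next
    fix y assume "y \<in> (\<Union>t\<in>Collect (nielsen G {..<n} (\<lambda>i. q (free_gen i))). t ` {..<n})"
    then obtain t k where t: "nielsen G {..<n} (\<lambda>i. q (free_gen i)) t" "k \<in> {..<n}" "y = t k"
      by (elim UN_E CollectE imageE)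
    from nielsen_lift[OF t(1) group_free_group assms gen] obtain g
      where g: "nielsen (free_group {..<n}) {..<n} free_gen g" "\<forall>i\<in>{..<n}. t i = q (g i)"
      by (elim exE conjE)
    have "primitive (free_group {..<n}) (g k)"
      unfolding primitive_iff_nielsen using g(1) t(2) by (intro exI[of _ g] conjI imageI)
    moreover have "y = q (g k)" using g(2) t(2,3) by simp
    ultimately show "y \<in> q ` {x. primitive (free_group {..<n}) x}" by (intro image_eqI CollectI)
  }
qed

section \<open>Computable functions\<close>

text \<open>Arguments are passed as environments \<open>nat \<Rightarrow> nat\<close> and not as lists: then the variable bound by a
quantifier or a recursion is position 0, the others are shifted by \<open>Suc\<close>, and \<open>\<beta>\<close>-reduction alone
brings the premises of the closure rules below into the form of their conclusions.\<close>

definition computable :: "nat \<Rightarrow> ((nat \<Rightarrow> nat) \<Rightarrow> nat) \<Rightarrow> bool" where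
  "computable k f \<longleftrightarrow> (\<exists>p. \<forall>xs. length xs = k \<longrightarrow> evaluates p xs (f (nth xs)))"

definition decidable :: "nat \<Rightarrow> ((nat \<Rightarrow> nat) \<Rightarrow> bool) \<Rightarrow> bool" where
  "decidable k P \<longleftrightarrow> (\<exists>f. computable k f \<and> (\<forall>e. P e \<longleftrightarrow> f e = 0))"

lemma computable_proj: "i < k \<Longrightarrow> computable k (\<lambda>e. e i)"
  unfolding computable_def by (rule exI[of _ "Proj i"]) (auto intro: evaluates.Proj)

lemma computable_0: "computable k (\<lambda>e. 0)"
  unfolding computable_def by (rule exI[of _ Zero]) (auto intro: evaluates.Zero)

lemma computable_Suc: "computable k f \<Longrightarrow> computable k (\<lambda>e. Suc (f e))"
  unfolding computable_def
proof (elim exE)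
  fix p assume p: "\<forall>xs. length xs = k \<longrightarrow> evaluates p xs (f (nth xs))"
  show "\<exists>p. \<forall>xs. length xs = k \<longrightarrow> evaluates p xs (Suc (f (nth xs)))"
    using p by (intro exI[of _ "Comp Succ [p]"]) (auto intro!: evaluates.Comp[OF _ evaluates.Succ])
qed

lemma computable_rec:
  assumes "computable k f" "computable (Suc (Suc k)) (\<lambda>e. s (e 0) (e 1) (\<lambda>i. e (Suc (Suc i))))"
    "computable k h"
  shows "computable k (\<lambda>e. rec_nat (f e) (\<lambda>i r. s i r e) (h e))"
proof -
  obtain p where p: "\<And>xs. length xs = k \<Longrightarrow> evaluates p xs (f (nth xs))"
    using assms(1) by (auto simp: computable_def)
  obtain p' where p': "\<And>xs. length xs = Suc (Suc k) \<Longrightarrow>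
      evaluates p' xs (s (xs ! 0) (xs ! 1) (\<lambda>i. xs ! Suc (Suc i)))"
    using assms(2) by (auto simp: computable_def)
  obtain p'' where p'': "\<And>xs. length xs = k \<Longrightarrow> evaluates p'' xs (h (nth xs))"
    using assms(3) by (auto simp: computable_def)
  have rec: "evaluates (Prec p p') (a # xs) (rec_nat (f (nth xs)) (\<lambda>i r. s i r (nth xs)) a)"
    if len: "length xs = k" for xs a
  proof (induction a)
    case 0
    then show ?case using p[OF len] by (auto intro: evaluates.Prec_0)
  next
    case (Suc a)
    let ?r = "rec_nat (f (nth xs)) (\<lambda>i r. s i r (nth xs)) a"
    have "evaluates p' (a # ?r # xs) (s a ?r (nth xs))"
      using p'[of "a # ?r # xs"] len by simp
    then show ?case using Suc by (auto intro: evaluates.Prec_Suc)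
  qed
  have "evaluates (Comp (Prec p p') (p'' # map Proj [0..<k])) xs
      (rec_nat (f (nth xs)) (\<lambda>i r. s i r (nth xs)) (h (nth xs)))"
    if len: "length xs = k" for xs
  proof (rule evaluates.Comp[OF _ rec[OF len]])
    show "list_all2 (\<lambda>g y. evaluates g xs y) (p'' # map Proj [0..<k]) (h (nth xs) # xs)"
      using p''[OF len] len
      by (auto simp: list_all2_conv_all_nth nth_Cons split: nat.splits intro: evaluates.Proj)
  qed
  then show ?thesis unfolding computable_def by blast
qed

text \<open>Recursions and quantifiers add arguments in front that the functions inside do not see; this
supplies the renumbering.\<close>

lemma computable_select:
  assumes "computable k f" "length is = k" "set is \<subseteq> {..<j}"
    and sel: "\<And>xs. length xs = j \<Longrightarrow> nth (map (nth xs) is) = s (nth xs)"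
  shows "computable j (\<lambda>e. f (s e))"
proof -
  obtain p where p: "\<And>xs. length xs = k \<Longrightarrow> evaluates p xs (f (nth xs))"
    using assms(1) by (auto simp: computable_def)
  have "evaluates (Comp p (map Proj is)) xs (f (s (nth xs)))" if len: "length xs = j" for xs
  proof (rule evaluates.Comp)
    show "evaluates p (map (nth xs) is) (f (s (nth xs)))"
      using p[of "map (nth xs) is"] assms(2) by (simp add: sel[OF len])
    show "list_all2 (\<lambda>g y. evaluates g xs y) (map Proj is) (map (nth xs) is)"
      using assms(3) len
      by (auto simp: list_all2_conv_all_nth subset_iff intro!: evaluates.Proj)
  qed
  then show ?thesis unfolding computable_def by blast
qed

lemma computable_weaken:
  assumes "computable k f"
  shows "computable (Suc k) (\<lambda>e. f (\<lambda>i. e (Suc i)))"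
proof (rule computable_select[OF assms, of "[1..<Suc k]"])
  fix xs :: "nat list" assume "length xs = Suc k"
  then obtain a ys where "xs = a # ys" "length ys = k" by (auto simp: length_Suc_conv)
  moreover have "map (nth (a # ys)) [1..<Suc (length ys)] = ys"
    by (rule nth_equalityI) (auto simp del: upt_Suc)
  ultimately show "nth (map (nth xs) [1..<Suc k]) = (\<lambda>i. xs ! Suc i)"
    by (simp add: fun_eq_iff del: upt_Suc)
qed auto

text \<open>Unbounded search. The result is partial: it halts on those inputs for which a solution exists.\<close>

lemma least_computable:
  assumes "decidable (Suc k) (\<lambda>e. P (e 0) (\<lambda>i. e (Suc i)))"
  shows "\<exists>p. \<forall>xs. length xs = k \<longrightarrow> (\<exists>i. P i (nth xs)) \<longrightarrow> evaluates p xs (LEAST i. P i (nth xs))"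
proof -
  obtain f where f: "computable (Suc k) f" "\<And>e. P (e 0) (\<lambda>i. e (Suc i)) \<longleftrightarrow> f e = 0"
    using assms by (auto simp: decidable_def)
  obtain p where p: "\<And>xs. length xs = Suc k \<Longrightarrow> evaluates p xs (f (nth xs))"
    using f(1) by (auto simp: computable_def)
  have P: "P i (nth xs) \<longleftrightarrow> f (nth (i # xs)) = 0" for i xs
    using f(2)[of "nth (i # xs)"] by simp
  have "evaluates (Mu p) xs (LEAST i. P i (nth xs))"
    if len: "length xs = k" and ex: "\<exists>i. P i (nth xs)" for xs
  proof (rule evaluates.Mu)
    let ?m = "LEAST i. P i (nth xs)"
    show "evaluates p (?m # xs) 0"
      using p[of "?m # xs"] len LeastI_ex[OF ex] P[of ?m xs] by simp
    show "\<forall>j<?m. \<exists>y. evaluates p (j # xs) (Suc y)"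
    proof (intro allI impI)
      fix j assume "j < ?m"
      then have "\<not> P j (nth xs)" by (rule not_less_Least)
      then have "f (nth (j # xs)) \<noteq> 0" using P by simp
      then show "\<exists>y. evaluates p (j # xs) (Suc y)"
        using p[of "j # xs"] len by (metis length_Cons not0_implies_Suc)
    qed
  qed
  then show ?thesis by blast
qed

lemma computable_Least:
  assumes "decidable (Suc k) (\<lambda>e. P (e 0) (\<lambda>i. e (Suc i)))" "\<And>e. \<exists>i. P i e"
  shows "computable k (\<lambda>e. LEAST i. P i e)"
  using least_computable[OF assms(1)] assms(2) unfolding computable_def by blast

lemma computable_const: "computable k (\<lambda>e. c)"
  by (induction c) (auto intro: computable_0 computable_Suc)

lemma computable_comp1:
  assumes "computable 1 (\<lambda>e. F (e 0))" "computable k f"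
  shows "computable k (\<lambda>e. F (f e))"
proof -
  obtain p where p: "\<And>xs. length xs = 1 \<Longrightarrow> evaluates p xs (F (xs ! 0))"
    using assms(1) by (auto simp: computable_def)
  have p: "evaluates p [a] (F a)" for a using p[of "[a]"] by simp
  obtain pf where pf: "\<And>xs. length xs = k \<Longrightarrow> evaluates pf xs (f (nth xs))"
    using assms(2) by (auto simp: computable_def)
  have "evaluates (Comp p [pf]) xs (F (f (nth xs)))" if "length xs = k" for xs
    by (rule evaluates.Comp[OF _ p]) (use that pf in simp)
  then show ?thesis unfolding computable_def by blast
qed

lemma computable_comp2:
  assumes "computable 2 (\<lambda>e. F (e 0) (e 1))" "computable k f" "computable k g"
  shows "computable k (\<lambda>e. F (f e) (g e))"
proof -
  obtain p where p: "\<And>xs. length xs = 2 \<Longrightarrow> evaluates p xs (F (xs ! 0) (xs ! 1))"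
    using assms(1) by (auto simp: computable_def)
  have p: "evaluates p [a, b] (F a b)" for a b using p[of "[a, b]"] by simp
  obtain pf where pf: "\<And>xs. length xs = k \<Longrightarrow> evaluates pf xs (f (nth xs))"
    using assms(2) by (auto simp: computable_def)
  obtain pg where pg: "\<And>xs. length xs = k \<Longrightarrow> evaluates pg xs (g (nth xs))"
    using assms(3) by (auto simp: computable_def)
  have "evaluates (Comp p [pf, pg]) xs (F (f (nth xs)) (g (nth xs)))" if "length xs = k" for xs
    by (rule evaluates.Comp[OF _ p]) (use that pf pg in simp)
  then show ?thesis unfolding computable_def by blast
qed

lemma computable_add:
  assumes "computable k f" "computable k g"
  shows "computable k (\<lambda>e. f e + g e)"
proof -
  have "computable k (\<lambda>e. rec_nat (f e) (\<lambda>i r. Suc r) (g e))"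
    by (intro computable_rec assms computable_Suc computable_proj) simp
  moreover have "rec_nat a (\<lambda>i r. Suc r) b = a + b" for a b by (induction b) auto
  ultimately show ?thesis by simp
qed

lemma computable_diff:
  assumes "computable k f" "computable k g"
  shows "computable k (\<lambda>e. f e - g e)"
proof -
  have pred: "computable j (\<lambda>e. h e - 1)" if "computable j h" for j h
  proof -
    have "computable j (\<lambda>e. rec_nat 0 (\<lambda>i r. i) (h e))"
      by (intro computable_rec that computable_0 computable_proj) simp
    moreover have "rec_nat 0 (\<lambda>i r. i) b = b - 1" for b :: nat by (cases b) auto
    ultimately show ?thesis by simp
  qed
  have "computable k (\<lambda>e. rec_nat (f e) (\<lambda>i r. r - 1) (g e))"
    by (intro computable_rec assms pred computable_proj) simp
  moreover have "rec_nat a (\<lambda>i r. r - 1) b = a - b" for a b :: nat by (induction b) auto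
  ultimately show ?thesis by simp
qed

lemma computable_mult:
  assumes "computable k f" "computable k g"
  shows "computable k (\<lambda>e. f e * g e)"
proof (rule computable_comp2[OF _ assms])
  have "computable 2 (\<lambda>e. rec_nat 0 (\<lambda>i r. r + e 0) (e 1))"
    by (intro computable_rec computable_0 computable_add computable_proj) simp_all
  moreover have "rec_nat 0 (\<lambda>i r. r + a) b = a * b" for a b :: nat by (induction b) auto
  ultimately show "computable 2 (\<lambda>e. e 0 * e 1)" by simp
qed

lemma computable_power2:
  assumes "computable k f"
  shows "computable k (\<lambda>e. 2 ^ f e)"
proof -
  have "computable k (\<lambda>e. rec_nat 1 (\<lambda>i r. r * 2) (f e))"
    by (intro computable_rec assms computable_mult computable_const computable_proj) simp
  moreover have "rec_nat 1 (\<lambda>i r. r * 2) b = (2 ^ b :: nat)" for b by (induction b) auto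
  ultimately show ?thesis by simp
qed

lemma decidable_eq:
  assumes "computable k f" "computable k g"
  shows "decidable k (\<lambda>e. f e = g e)"
  unfolding decidable_def
  by (rule exI[of _ "\<lambda>e. (f e - g e) + (g e - f e)"])
    (auto intro!: computable_add computable_diff assms)

lemma decidable_less:
  assumes "computable k f" "computable k g"
  shows "decidable k (\<lambda>e. f e < g e)"
  unfolding decidable_def
  by (rule exI[of _ "\<lambda>e. Suc (f e) - g e"]) (auto intro!: computable_Suc computable_diff assms)

lemma decidable_not:
  assumes "decidable k P"
  shows "decidable k (\<lambda>e. \<not> P e)"
proof -
  obtain f where "computable k f" "\<And>e. P e \<longleftrightarrow> f e = 0" using assms by (auto simp: decidable_def)
  then show ?thesis
    unfolding decidable_def
    by (intro exI[of _ "\<lambda>e. 1 - f e"]) (auto intro!: computable_diff computable_const)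
qed

lemma decidable_conj:
  assumes "decidable k P" "decidable k Q"
  shows "decidable k (\<lambda>e. P e \<and> Q e)"
proof -
  obtain f where "computable k f" "\<And>e. P e \<longleftrightarrow> f e = 0"
    using assms(1) by (auto simp: decidable_def)
  moreover obtain g where "computable k g" "\<And>e. Q e \<longleftrightarrow> g e = 0"
    using assms(2) by (auto simp: decidable_def)
  ultimately show ?thesis
    unfolding decidable_def by (intro exI[of _ "\<lambda>e. f e + g e"]) (auto intro!: computable_add)
qed

lemma decidable_imp:
  assumes "decidable k P" "decidable k Q"
  shows "decidable k (\<lambda>e. P e \<longrightarrow> Q e)"
proof -
  have "decidable k (\<lambda>e. \<not> (P e \<and> \<not> Q e))"
    by (intro decidable_not decidable_conj assms)
  then show ?thesis by simp
qed

text \<open>Natural numbers all vanish iff their sum does, and the sum is a primitive recursion on the bound.\<close>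

lemma decidable_all_less:
  assumes "decidable (Suc k) (\<lambda>e. P (e 0) (\<lambda>i. e (Suc i)))" "computable k b"
  shows "decidable k (\<lambda>e. \<forall>i<b e. P i e)"
proof -
  obtain f where f: "computable (Suc k) f" "\<And>e. P (e 0) (\<lambda>i. e (Suc i)) \<longleftrightarrow> f e = 0"
    using assms(1) by (auto simp: decidable_def)
  have P: "P i e \<longleftrightarrow> f (case_nat i e) = 0" for i e
    using f(2)[of "case_nat i e"] by simp
  have "computable (Suc (Suc k)) (\<lambda>e. f (case_nat (e 0) (\<lambda>i. e (Suc (Suc i)))))"
  proof (rule computable_select[OF f(1), of "0 # [2..<Suc (Suc k)]"])
    fix xs :: "nat list" assume "length xs = Suc (Suc k)"
    then obtain a r ys where "xs = a # r # ys" "length ys = k"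
      by (auto simp: length_Suc_conv)
    moreover have "map (nth (a # r # ys)) [2..<Suc (Suc (length ys))] = ys"
      by (rule nth_equalityI) (auto simp del: upt_Suc)
    ultimately show "nth (map (nth xs) (0 # [2..<Suc (Suc k)])) = case_nat (xs ! 0) (\<lambda>i. xs ! Suc (Suc i))"
      by (auto simp: nth_Cons fun_eq_iff simp del: upt_Suc)
  qed auto
  then have "computable k (\<lambda>e. rec_nat 0 (\<lambda>i r. r + f (case_nat i e)) (b e))"
    by (intro computable_rec computable_0 computable_add computable_proj assms(2)) simp_all
  moreover have "rec_nat 0 (\<lambda>i r. r + f (case_nat i e)) c = 0 \<longleftrightarrow> (\<forall>i<c. P i e)" for c e
    by (induction c) (auto simp: P less_Suc_eq)
  ultimately show ?thesis unfolding decidable_def by blast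
qed

lemma decidable_ex_less:
  assumes "decidable (Suc k) (\<lambda>e. P (e 0) (\<lambda>i. e (Suc i)))" "computable k b"
  shows "decidable k (\<lambda>e. \<exists>i<b e. P i e)"
proof -
  have "decidable k (\<lambda>e. \<not> (\<forall>i<b e. \<not> P i e))"
    by (intro decidable_not decidable_all_less assms)
  then show ?thesis by simp
qed

lemmas computable_arith = computable_proj computable_const computable_Suc computable_add
  computable_mult computable_diff computable_power2
lemmas decidable_arith = decidable_eq decidable_less decidable_not decidable_conj decidable_imp
  decidable_all_less decidable_ex_less

section \<open>Computing with codes of lists and sets\<close>

lemma computable_prod_encode:
  assumes "computable k f" "computable k g"
  shows "computable k (\<lambda>e. prod_encode (f e, g e))"
proof -
  have *: "computable k (\<lambda>e. rec_nat 0 (\<lambda>i r. r + Suc i) (f e + g e) + f e)"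
    by (intro computable_rec computable_arith assms) simp_all
  have "rec_nat 0 (\<lambda>i r. r + Suc i) c = triangle c" for c
    by (induction c) auto
  with * show ?thesis by (simp add: prod_encode_def)
qed

text \<open>\<open>list_encode (x # xs)\<close> is the successor of the code of a pair, whence the subtraction.\<close>

definition code_hd :: "nat \<Rightarrow> nat" where
  "code_hd z = fst (prod_decode (z - 1))"

definition code_tl :: "nat \<Rightarrow> nat" where
  "code_tl z = snd (prod_decode (z - 1))"

definition code_nth :: "nat \<Rightarrow> nat \<Rightarrow> nat" where
  "code_nth z i = code_hd ((code_tl ^^ i) z)"

lemma code_nth_list_encode: "i < length xs \<Longrightarrow> code_nth (list_encode xs) i = xs ! i"
proof (induction xs arbitrary: i)
  case (Cons x xs)
  then show ?case
    by (cases i) (simp_all add: code_nth_def code_hd_def code_tl_def funpow_swap1)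
qed simp

text \<open>The components of a coded pair are found by search, and both are bounded by the code.\<close>

lemma computable_code_nth:
  assumes "computable k f" "computable k g"
  shows "computable k (\<lambda>e. code_nth (f e) (g e))"
proof (rule computable_comp2[OF _ assms])
  have fst_eq: "code_hd z = (LEAST a. \<exists>b<Suc z. prod_encode (a, b) = z - 1)" for z
  proof (rule Least_equality[symmetric])
    have "snd (prod_decode (z - 1)) \<le> z - 1"
      using le_prod_encode_2[of "snd (prod_decode (z - 1))" "fst (prod_decode (z - 1))"] by simp
    then show "\<exists>b<Suc z. prod_encode (code_hd z, b) = z - 1"
      by (intro exI[of _ "snd (prod_decode (z - 1))"]) (auto simp: code_hd_def)
  qed (metis code_hd_def fst_conv order_refl prod_encode_inverse)
  have snd_eq: "code_tl z = (LEAST b. \<exists>a<Suc z. prod_encode (a, b) = z - 1)" for z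
  proof (rule Least_equality[symmetric])
    have "fst (prod_decode (z - 1)) \<le> z - 1"
      using le_prod_encode_1[of "fst (prod_decode (z - 1))" "snd (prod_decode (z - 1))"] by simp
    then show "\<exists>a<Suc z. prod_encode (a, code_tl z) = z - 1"
      by (intro exI[of _ "fst (prod_decode (z - 1))"]) (auto simp: code_tl_def)
  qed (metis code_tl_def snd_conv order_refl prod_encode_inverse)
  have ex: "\<exists>a. \<exists>b<Suc z. prod_encode (a, b) = z - 1" "\<exists>b. \<exists>a<Suc z. prod_encode (a, b) = z - 1" for z
    using le_prod_encode_1 le_prod_encode_2
    by (metis diff_le_self le_imp_less_Suc le_trans prod_decode_inverse surj_pair)+
  have hd: "computable k (\<lambda>e. code_hd (h e))" if "computable k h" for k h
  proof (rule computable_comp1[OF _ that])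
    show "computable 1 (\<lambda>e. code_hd (e 0))"
      unfolding fst_eq
      by (intro computable_Least decidable_arith computable_arith computable_prod_encode ex) simp_all
  qed
  have tl: "computable k (\<lambda>e. code_tl (h e))" if "computable k h" for k h
  proof (rule computable_comp1[OF _ that])
    show "computable 1 (\<lambda>e. code_tl (e 0))"
      unfolding snd_eq
      by (intro computable_Least decidable_arith computable_arith computable_prod_encode ex) simp_all
  qed
  have "computable 2 (\<lambda>e. code_hd (rec_nat (e 0) (\<lambda>i r. code_tl r) (e 1)))"
    by (intro hd computable_rec tl computable_proj) simp_all
  moreover have "rec_nat z (\<lambda>i r. code_tl r) i = (code_tl ^^ i) z" for z i
    by (induction i) auto
  ultimately show "computable 2 (\<lambda>e. code_nth (e 0) (e 1))"
    by (simp add: code_nth_def)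
qed

text \<open>Bit \<open>x\<close> of \<open>c\<close> is set iff \<open>c\<close> splits into an odd multiple of \<open>2 ^ x\<close> and a remainder; in this form all
quantifiers are bounded by computable functions.\<close>

lemma mem_set_decode_iff:
  "x \<in> set_decode c \<longleftrightarrow> (\<exists>a<Suc c. \<exists>r<2 ^ x. c = (2 * a + 1) * 2 ^ x + r)"
proof
  assume "x \<in> set_decode c"
  then obtain a where a: "c div 2 ^ x = 2 * a + 1" by (auto simp: set_decode_def elim: oddE)
  then have "c = (2 * a + 1) * 2 ^ x + c mod 2 ^ x" by (metis div_mult_mod_eq)
  moreover have "a < Suc c"
    using a div_le_dividend[of c "2 ^ x"] by simp
  ultimately show "\<exists>a<Suc c. \<exists>r<2 ^ x. c = (2 * a + 1) * 2 ^ x + r"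
    by (metis mod_less_divisor zero_less_numeral zero_less_power)
next
  assume "\<exists>a<Suc c. \<exists>r<2 ^ x. c = (2 * a + 1) * 2 ^ x + r"
  then obtain a r where "r < 2 ^ x" "c = r + (2 * a + 1) * 2 ^ x" by (auto simp: add.commute)
  then have "c div 2 ^ x = 2 * a + 1" using div_mult_self1[of "2 ^ x" r "2 * a + 1"] by simp
  then show "x \<in> set_decode c" by (simp add: set_decode_def)
qed

lemma decidable_mem_set_decode:
  assumes f: "computable k f" and g: "computable k g"
  shows "decidable k (\<lambda>e. f e \<in> set_decode (g e))"
  unfolding mem_set_decode_iff
  by (intro decidable_arith computable_arith assms computable_weaken[OF f] computable_weaken[OF g]
      computable_weaken[OF computable_weaken[OF f]] computable_weaken[OF computable_weaken[OF g]])
    simp_all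

lemma mem_set_decode_less: "x \<in> set_decode c \<Longrightarrow> x < c"
proof -
  assume "x \<in> set_decode c"
  then have "c div 2 ^ x \<noteq> 0" by (auto simp: set_decode_def intro: ccontr)
  then have "2 ^ x \<le> c" by (metis div_less not_le)
  then show "x < c" using less_exp[of x] by linarith
qed

lemma decidable_all_set_decode:
  assumes "decidable (Suc k) (\<lambda>e. P (e 0) (\<lambda>i. e (Suc i)))" "computable k f"
  shows "decidable k (\<lambda>e. \<forall>x\<in>set_decode (f e). P x e)"
proof -
  have "decidable k (\<lambda>e. \<forall>x<f e. x \<in> set_decode (f e) \<longrightarrow> P x e)"
    by (intro decidable_all_less decidable_imp decidable_mem_set_decode computable_proj assms
        computable_weaken[OF assms(2)]) simp
  moreover have "(\<forall>x<c. x \<in> set_decode c \<longrightarrow> Q x) \<longleftrightarrow> (\<forall>x\<in>set_decode c. Q x)" for c Q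
    by (auto dest: mem_set_decode_less)
  ultimately show ?thesis by simp
qed

lemma decidable_ex_set_decode:
  assumes "decidable (Suc k) (\<lambda>e. P (e 0) (\<lambda>i. e (Suc i)))" "computable k f"
  shows "decidable k (\<lambda>e. \<exists>x\<in>set_decode (f e). P x e)"
proof -
  have "decidable k (\<lambda>e. \<not> (\<forall>x\<in>set_decode (f e). \<not> P x e))"
    by (intro decidable_not decidable_all_set_decode assms)
  then show ?thesis by simp
qed

section \<open>Orbits of coded tuples\<close>

definition code_mult :: "nat \<Rightarrow> nat \<Rightarrow> nat \<Rightarrow> nat" where
  "code_mult T a b = code_nth (code_nth T a) b"

text \<open>\<open>C\<close> codes a set of list codes. A list stands for the tuple of its first \<open>n\<close> entries, so that the new
tuple after a move can be described by its entries instead of being constructed. The inverse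
\<open>b\<close> of \<open>a\<close> is recognised in the multiplication table by \<open>(b * a) * a = a\<close>, without knowing the name
of the identity; the bound \<open>m\<close> keeps \<open>b\<close> inside the table.\<close>

definition orbit_closed :: "nat \<Rightarrow> nat \<Rightarrow> nat \<Rightarrow> nat \<Rightarrow> nat \<Rightarrow> bool" where
  "orbit_closed C n m T t \<longleftrightarrow>
    (\<exists>x\<in>set_decode C. \<forall>k<n. code_nth x k = code_nth t k) \<and>
    (\<forall>x\<in>set_decode C. \<forall>i<n.
      (\<exists>y\<in>set_decode C. (\<forall>k<n. k \<noteq> i \<longrightarrow> code_nth y k = code_nth x k) \<and> code_nth y i < m \<and>
         code_mult T (code_mult T (code_nth y i) (code_nth x i)) (code_nth x i) = code_nth x i) \<and>
      (\<forall>j<n. j \<noteq> i \<longrightarrow>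
        (\<exists>y\<in>set_decode C. (\<forall>k<n. k \<noteq> i \<longrightarrow> code_nth y k = code_nth x k) \<and>
           code_nth y i = code_mult T (code_nth x i) (code_nth x j))))"

definition covers_entries :: "nat \<Rightarrow> nat \<Rightarrow> nat \<Rightarrow> bool" where
  "covers_entries D C n \<longleftrightarrow> (\<forall>x\<in>set_decode C. \<forall>k<n. code_nth x k \<in> set_decode D)"

lemma decidable_orbit_closed: "decidable 5 (\<lambda>e. orbit_closed (e 0) (e 1) (e 2) (e 3) (e 4))"
  unfolding orbit_closed_def code_mult_def
  by (intro decidable_conj decidable_imp decidable_not decidable_ex_set_decode
      decidable_all_set_decode decidable_all_less decidable_eq decidable_less computable_code_nth
      computable_proj) simp_all

lemma decidable_covers_entries: "decidable 3 (\<lambda>e. covers_entries (e 0) (e 1) (e 2))"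
  unfolding covers_entries_def
  by (intro decidable_all_set_decode decidable_all_less decidable_mem_set_decode
      computable_code_nth computable_proj) simp_all

lemma entries_algorithm:
  "\<exists>P. \<forall>n m T t. (\<exists>C. orbit_closed C n m T t) \<longrightarrow>
     evaluates P [n, m, T, t]
       (LEAST D. covers_entries D (LEAST C. orbit_closed C n m T t) n)"
proof -
  have "decidable (Suc 4) (\<lambda>e. orbit_closed (e 0) (e 1) (e 2) (e 3) (e 4))"
    using decidable_orbit_closed by simp
  then have "decidable (Suc 4) (\<lambda>e. (\<lambda>C e. orbit_closed C (e 0) (e 1) (e 2) (e 3)) (e 0) (\<lambda>i. e (Suc i)))"
    by (simp add: eval_nat_numeral)
  from least_computable[OF this] obtain p where p: "\<And>xs. length xs = 4 \<Longrightarrow>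
      \<exists>C. orbit_closed C (xs ! 0) (xs ! 1) (xs ! 2) (xs ! 3) \<Longrightarrow>
      evaluates p xs (LEAST C. orbit_closed C (xs ! 0) (xs ! 1) (xs ! 2) (xs ! 3))"
    by auto
  have "decidable (Suc 2) (\<lambda>e. (\<lambda>D e. covers_entries D (e 0) (e 1)) (e 0) (\<lambda>i. e (Suc i)))"
    using decidable_covers_entries by (simp add: eval_nat_numeral)
  from least_computable[OF this] obtain p' where p': "\<And>xs. length xs = 2 \<Longrightarrow>
      \<exists>D. covers_entries D (xs ! 0) (xs ! 1) \<Longrightarrow>
      evaluates p' xs (LEAST D. covers_entries D (xs ! 0) (xs ! 1))"
    by auto
  have covers: "\<exists>D. covers_entries D C n" for C n
  proof
    let ?D = "(\<Union>x\<in>set_decode C. code_nth x ` {..<n})"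
    have "finite ?D" by simp
    then show "covers_entries (set_encode ?D) C n"
      by (auto simp: covers_entries_def set_encode_inverse)
  qed
  have "evaluates (Comp p' [p, Proj 0]) [n, m, T, t]
      (LEAST D. covers_entries D (LEAST C. orbit_closed C n m T t) n)"
    if "\<exists>C. orbit_closed C n m T t" for n m T t
  proof (rule evaluates.Comp)
    let ?C = "LEAST C. orbit_closed C n m T t"
    show "evaluates p' [?C, n] (LEAST D. covers_entries D ?C n)"
      using p'[of "[?C, n]"] covers by simp
    show "list_all2 (\<lambda>g y. evaluates g [n, m, T, t] y) [p, Proj 0] [?C, n]"
      using p[of "[n, m, T, t]"] that evaluates.Proj[of 0 "[n, m, T, t]"] by simp
  qed
  then show ?thesis by blast
qed

lemma set_encode_mono: "finite B \<Longrightarrow> A \<subseteq> B \<Longrightarrow> set_encode A \<le> set_encode B"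
  unfolding set_encode_def by (rule sum_mono2) auto

lemma least_covers_entries:
  "(LEAST D. covers_entries D C n) = set_encode (\<Union>x\<in>set_decode C. code_nth x ` {..<n})"
proof (rule Least_equality)
  let ?D = "(\<Union>x\<in>set_decode C. code_nth x ` {..<n})"
  have fin: "finite ?D" by simp
  then show "covers_entries (set_encode ?D) C n"
    by (auto simp: covers_entries_def set_encode_inverse)
  fix D assume "covers_entries D C n"
  then have "?D \<subseteq> set_decode D" by (auto simp: covers_entries_def)
  then have "set_encode ?D \<le> set_encode (set_decode D)" by (intro set_encode_mono) simp_all
  then show "set_encode ?D \<le> D" by simp
qed

locale coded_group = group G for G (structure) +
  fixes m :: nat and e :: "nat \<Rightarrow> 'a" and T n t :: nat
  assumes e: "bij_betw e {..<m} (carrier G)"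
    and T: "T = table_code G m e"
    and t: "\<forall>k<n. code_nth t k < m"
begin

lemma e_closed [simp]: "a < m \<Longrightarrow> e a \<in> carrier G"
  using e by (auto simp: bij_betw_def)

lemma e_inject: "a < m \<Longrightarrow> b < m \<Longrightarrow> e a = e b \<longleftrightarrow> a = b"
  using e by (auto simp: bij_betw_def inj_on_def)

lemma elem_code_less: "x \<in> carrier G \<Longrightarrow> elem_code m e x < m"
  using e inv_into_into[of x e "{..<m}"] by (auto simp: elem_code_def bij_betw_def)

lemma e_elem_code: "x \<in> carrier G \<Longrightarrow> e (elem_code m e x) = x"
  using e by (auto simp: elem_code_def bij_betw_def f_inv_into_f)

lemma elem_code_e: "a < m \<Longrightarrow> elem_code m e (e a) = a"
  using e by (auto simp: elem_code_def bij_betw_def)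

lemma code_mult_eq: "a < m \<Longrightarrow> b < m \<Longrightarrow> code_mult T a b = elem_code m e (e a \<otimes> e b)"
  by (simp add: code_mult_def T table_code_def code_nth_list_encode)

lemma code_mult_less: "a < m \<Longrightarrow> b < m \<Longrightarrow> code_mult T a b < m"
  by (simp add: code_mult_eq elem_code_less)

lemma e_code_mult: "a < m \<Longrightarrow> b < m \<Longrightarrow> e (code_mult T a b) = e a \<otimes> e b"
  by (simp add: code_mult_eq e_elem_code)

lemma code_inverse_iff:
  assumes "a < m" "b < m"
  shows "code_mult T (code_mult T b a) a = a \<longleftrightarrow> e b = inv (e a)"
proof -
  have "code_mult T (code_mult T b a) a = a \<longleftrightarrow> e b \<otimes> e a \<otimes> e a = e a"
    using assms by (simp add: code_mult_less flip: e_inject e_code_mult)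
  also have "\<dots> \<longleftrightarrow> e b \<otimes> e a = \<one>"
    using assms r_cancel_one[of "e a" "e b \<otimes> e a"] by simp
  also have "\<dots> \<longleftrightarrow> e b = inv (e a)"
    using assms inv_equality[of "e b" "e a"] by auto
  finally show ?thesis .
qed

definition orbit :: "nat set" where
  "orbit = {x. (\<forall>k<n. code_nth x k < m) \<and>
     nielsen G {..<n} (\<lambda>k. e (code_nth t k)) (\<lambda>k. e (code_nth x k))}"

lemma orbit_start: "\<forall>k<n. code_nth x k = code_nth t k \<Longrightarrow> x \<in> orbit"
  using t by (auto simp: orbit_def intro: nielsen_refl)

lemma orbit_inverse:
  assumes x: "x \<in> orbit" and i: "i < n" and y: "\<forall>k<n. k \<noteq> i \<longrightarrow> code_nth y k = code_nth x k" "code_nth y i < m"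
    "code_mult T (code_mult T (code_nth y i) (code_nth x i)) (code_nth x i) = code_nth x i"
  shows "y \<in> orbit"
proof -
  have xm: "\<And>k. k < n \<Longrightarrow> code_nth x k < m" using x by (simp add: orbit_def)
  then have "code_nth y k < m" if "k < n" for k using y that by (cases "k = i") auto
  moreover have "nielsen G {..<n} (\<lambda>k. e (code_nth t k)) (\<lambda>k. e (code_nth y k))"
    by (rule nielsen_inv[of G _ _ "\<lambda>k. e (code_nth x k)" i])
      (use x i y xm in \<open>auto simp: orbit_def code_inverse_iff\<close>)
  ultimately show ?thesis by (simp add: orbit_def)
qed

lemma orbit_mult:
  assumes x: "x \<in> orbit" and i: "i < n" "j < n" "j \<noteq> i"
    and y: "\<forall>k<n. k \<noteq> i \<longrightarrow> code_nth y k = code_nth x k"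
      "code_nth y i = code_mult T (code_nth x i) (code_nth x j)"
  shows "y \<in> orbit"
proof -
  have xm: "\<And>k. k < n \<Longrightarrow> code_nth x k < m" using x by (simp add: orbit_def)
  then have "code_nth y k < m" if "k < n" for k
    using y that i by (cases "k = i") (auto simp: code_mult_less)
  moreover have "nielsen G {..<n} (\<lambda>k. e (code_nth t k)) (\<lambda>k. e (code_nth y k))"
    by (rule nielsen_mult[of G _ _ "\<lambda>k. e (code_nth x k)" i j])
      (use x i y xm in \<open>auto simp: orbit_def e_code_mult\<close>)
  ultimately show ?thesis by (simp add: orbit_def)
qed

text \<open>All \<open>n\<close>-tuples of names together are closed under the moves, so the search for \<open>C\<close> halts.\<close>

lemma ex_orbit_closed: "\<exists>C. orbit_closed C n m T t"
proof
  let ?L = "{xs. set xs \<subseteq> {..<m} \<and> length xs = n}"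
  have "finite (list_encode ` ?L)" by (intro finite_imageI finite_lists_length_eq) simp
  then have dec: "set_decode (set_encode (list_encode ` ?L)) = list_encode ` ?L"
    by (rule set_encode_inverse)
  have upd: "list_encode (xs[i := z]) \<in> list_encode ` ?L"
    "\<forall>k<n. k \<noteq> i \<longrightarrow> code_nth (list_encode (xs[i := z])) k = code_nth (list_encode xs) k"
    "code_nth (list_encode (xs[i := z])) i = z" if "xs \<in> ?L" "i < n" "z < m" for xs i z
  proof -
    have "set (xs[i := z]) \<subseteq> {..<m}" using that by (intro set_update_subsetI) auto
    then show "list_encode (xs[i := z]) \<in> list_encode ` ?L" using that(1) by (intro imageI) simp
  qed (use that in \<open>simp_all add: code_nth_list_encode\<close>)
  show "orbit_closed (set_encode (list_encode ` ?L)) n m T t"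
    unfolding orbit_closed_def dec
  proof (intro conjI ballI allI impI)
    show "\<exists>x\<in>list_encode ` ?L. \<forall>k<n. code_nth x k = code_nth t k"
      using t by (intro bexI[of _ "list_encode (map (code_nth t) [0..<n])"] imageI)
        (auto simp: code_nth_list_encode)
    fix x i assume x: "x \<in> list_encode ` ?L" and i: "i < n"
    obtain xs where xs: "x = list_encode xs" "xs \<in> ?L" using x by blast
    have xm: "code_nth x k < m" if "k < n" for k
    proof -
      have "k < length xs" "set xs \<subseteq> {..<m}" using xs(2) that by simp_all
      then have "xs ! k \<in> {..<m}" using nth_mem by blast
      then show ?thesis using xs that by (simp add: code_nth_list_encode)
    qed
    let ?z = "elem_code m e (inv (e (code_nth x i)))"
    have z: "?z < m" "e ?z = inv (e (code_nth x i))"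
      using xm[OF i] by (simp_all add: elem_code_less e_elem_code)
    note u = upd[OF xs(2) i z(1), folded xs(1)]
    show "\<exists>y\<in>list_encode ` ?L. (\<forall>k<n. k \<noteq> i \<longrightarrow> code_nth y k = code_nth x k) \<and> code_nth y i < m \<and>
         code_mult T (code_mult T (code_nth y i) (code_nth x i)) (code_nth x i) = code_nth x i"
      using u(1,2) z code_inverse_iff[OF xm[OF i] z(1)]
      by (intro bexI[OF _ u(1)]) (simp add: u(3))
    fix j assume j: "j < n"
    note u = upd[OF xs(2) i code_mult_less[OF xm[OF i] xm[OF j]], folded xs(1)]
    show "\<exists>y\<in>list_encode ` ?L. (\<forall>k<n. k \<noteq> i \<longrightarrow> code_nth y k = code_nth x k) \<and>
           code_nth y i = code_mult T (code_nth x i) (code_nth x j)"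
      using u by blast
  qed
qed

text \<open>Dropping from \<open>C\<close> all codes outside the orbit leaves a closed set with a code that is not larger, so
nothing is dropped from the least one.\<close>

lemma least_orbit_closed_subset:
  assumes C: "C = (LEAST C. orbit_closed C n m T t)"
  shows "orbit_closed C n m T t" "set_decode C \<subseteq> orbit"
proof -
  show closed: "orbit_closed C n m T t"
    unfolding C by (rule LeastI_ex[OF ex_orbit_closed])
  let ?C = "set_encode (set_decode C \<inter> orbit)"
  have dec: "set_decode ?C = set_decode C \<inter> orbit"
    by (rule set_encode_inverse) simp
  have "orbit_closed ?C n m T t"
    unfolding orbit_closed_def dec
  proof (intro conjI ballI allI impI)
    show "\<exists>x\<in>set_decode C \<inter> orbit. \<forall>k<n. code_nth x k = code_nth t k"
      using closed orbit_start unfolding orbit_closed_def by blast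
    fix x i assume x: "x \<in> set_decode C \<inter> orbit" and i: "i < n"
    show "\<exists>y\<in>set_decode C \<inter> orbit. (\<forall>k<n. k \<noteq> i \<longrightarrow> code_nth y k = code_nth x k) \<and>
       code_nth y i < m \<and>
       code_mult T (code_mult T (code_nth y i) (code_nth x i)) (code_nth x i) = code_nth x i"
      using closed x i orbit_inverse[of x i] unfolding orbit_closed_def by (metis IntD1 IntD2 IntI)
    fix j assume j: "j < n" "j \<noteq> i"
    show "\<exists>y\<in>set_decode C \<inter> orbit. (\<forall>k<n. k \<noteq> i \<longrightarrow> code_nth y k = code_nth x k) \<and>
           code_nth y i = code_mult T (code_nth x i) (code_nth x j)"
      using closed x i j orbit_mult[of x i j] unfolding orbit_closed_def by (metis IntD1 IntD2 IntI)
  qed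
  then have "C \<le> ?C" unfolding C by (rule Least_le)
  moreover have "?C \<le> set_encode (set_decode C)" by (rule set_encode_mono) auto
  ultimately have "?C = C" by simp
  then show "set_decode C \<subseteq> orbit" using dec by auto
qed

text \<open>The other inclusion: a set that contains the start and is closed under the moves contains a code of
every tuple that the moves reach.\<close>

lemma nielsen_in_orbit_closed:
  assumes C: "orbit_closed C n m T t" "set_decode C \<subseteq> orbit"
    and "nielsen G {..<n} (\<lambda>k. e (code_nth t k)) g"
  shows "\<exists>x\<in>set_decode C. \<forall>k<n. e (code_nth x k) = g k"
  using assms(3)
proof (induction rule: nielsen.induct)
  case (nielsen_refl g)
  then show ?case using C(1) unfolding orbit_closed_def by (metis lessThan_iff)
next
  case (nielsen_inv g i g')
  then obtain x where x: "x \<in> set_decode C" "\<forall>k<n. e (code_nth x k) = g k" by blast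
  then have xm: "\<forall>k<n. code_nth x k < m" using C(2) by (auto simp: orbit_def)
  obtain y where y: "y \<in> set_decode C" "\<forall>k<n. k \<noteq> i \<longrightarrow> code_nth y k = code_nth x k"
    "code_nth y i < m"
    "code_mult T (code_mult T (code_nth y i) (code_nth x i)) (code_nth x i) = code_nth x i"
    using C(1) x(1) nielsen_inv.hyps(2) unfolding orbit_closed_def by (metis lessThan_iff)
  then have "e (code_nth y i) = inv (e (code_nth x i))"
    using code_inverse_iff[of "code_nth x i" "code_nth y i"] xm nielsen_inv.hyps(2) by simp
  then have "e (code_nth y k) = g' k" if "k < n" for k
    using that y x nielsen_inv.hyps by (cases "k = i") auto
  then show ?case using y(1) by blast
next
  case (nielsen_mult g i j g')
  then obtain x where x: "x \<in> set_decode C" "\<forall>k<n. e (code_nth x k) = g k" by blast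
  then have xm: "\<forall>k<n. code_nth x k < m" using C(2) by (auto simp: orbit_def)
  obtain y where y: "y \<in> set_decode C" "\<forall>k<n. k \<noteq> i \<longrightarrow> code_nth y k = code_nth x k"
    "code_nth y i = code_mult T (code_nth x i) (code_nth x j)"
    using C(1) x(1) nielsen_mult.hyps(2-4) unfolding orbit_closed_def by (metis lessThan_iff)
  then have "e (code_nth y i) = e (code_nth x i) \<otimes> e (code_nth x j)"
    using e_code_mult[of "code_nth x i" "code_nth x j"] xm nielsen_mult.hyps(2,3) by simp
  then have "e (code_nth y k) = g' k" if "k < n" for k
    using that y x nielsen_mult.hyps by (cases "k = i") auto
  then show ?case using y(1) by blast
qed

lemma least_orbit_entries:
  "(LEAST D. covers_entries D (LEAST C. orbit_closed C n m T t) n) =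
     set_encode (elem_code m e ` (\<Union>g\<in>Collect (nielsen G {..<n} (\<lambda>k. e (code_nth t k))). g ` {..<n}))"
proof -
  define C where "C = (LEAST C. orbit_closed C n m T t)"
  note C = least_orbit_closed_subset[OF C_def]
  have "(\<Union>x\<in>set_decode C. code_nth x ` {..<n}) =
    elem_code m e ` (\<Union>g\<in>Collect (nielsen G {..<n} (\<lambda>k. e (code_nth t k))). g ` {..<n})" (is "?l = ?r")
  proof (intro equalityI subsetI)
    fix a assume "a \<in> ?l"
    then obtain x k where x: "a = code_nth x k" "x \<in> set_decode C" "k < n" by blast
    then have "x \<in> orbit" using C(2) by blast
    then have "a = elem_code m e (e (code_nth x k))"
      "nielsen G {..<n} (\<lambda>k. e (code_nth t k)) (\<lambda>k. e (code_nth x k))"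
      using x by (auto simp: orbit_def elem_code_e)
    then show "a \<in> ?r" using x(3) by blast
  next
    fix a assume "a \<in> ?r"
    then obtain g k where g: "nielsen G {..<n} (\<lambda>k. e (code_nth t k)) g" "k < n" "a = elem_code m e (g k)"
      by blast
    obtain x where x: "x \<in> set_decode C" "\<forall>k<n. e (code_nth x k) = g k"
      using nielsen_in_orbit_closed[OF C g(1)] by blast
    then have "x \<in> orbit" using C(2) by blast
    then have "a = code_nth x k" using x g by (auto simp: orbit_def elem_code_e simp flip: x(2))
    then show "a \<in> ?l" using x(1) g(2) by blast
  qed
  then show ?thesis by (simp add: least_covers_entries flip: C_def)
qed

end

theorem proposition6p1:
  shows "\<exists>P :: recf. \<forall>(n :: nat) (m :: nat) (G :: ('a, 'b) monoid_scheme) (e :: nat \<Rightarrow> 'a) q.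
    group G \<longrightarrow> bij_betw e {..<m} (carrier G) \<longrightarrow> q \<in> hom (free_group {..<n}) G \<longrightarrow>
    evaluates P [n, m, table_code G m e, tuple_code m e n q]
      (set_encode (elem_code m e ` q ` {x. primitive (free_group {..<n}) x}))"
proof -
  obtain P where P: "\<And>n m T t. \<exists>C. orbit_closed C n m T t \<Longrightarrow>
     evaluates P [n, m, T, t] (LEAST D. covers_entries D (LEAST C. orbit_closed C n m T t) n)"
    using entries_algorithm by blast
  have "evaluates P [n, m, table_code G m e, tuple_code m e n q]
      (set_encode (elem_code m e ` q ` {x. primitive (free_group {..<n}) x}))"
    if G: "group G" and e: "bij_betw e {..<m} (carrier G)" and q: "q \<in> hom (free_group {..<n}) G"
    for n m and G :: "('a, 'b) monoid_scheme" and e q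
  proof -
    let ?T = "table_code G m e" and ?t = "tuple_code m e n q"
    have qc: "q (free_gen k) \<in> carrier G" if "k < n" for k
      using q that by (auto simp: hom_def)
    have nth: "code_nth ?t k = elem_code m e (q (free_gen k))" if "k < n" for k
      using that by (simp add: tuple_code_def code_nth_list_encode)
    have less: "elem_code m e (q (free_gen k)) < m"
      and e_code: "e (elem_code m e (q (free_gen k))) = q (free_gen k)" if "k < n" for k
      using e qc[OF that] inv_into_into[of _ e "{..<m}"]
      by (auto simp: elem_code_def bij_betw_def f_inv_into_f)
    interpret coded_group G m e ?T n ?t
      using G e less nth by (simp add: coded_group_def coded_group_axioms_def)
    have "nielsen G {..<n} (\<lambda>k. e (code_nth ?t k)) = nielsen G {..<n} (\<lambda>k. q (free_gen k))"
      by (intro ext iffI; erule nielsen_trans; intro nielsen_refl) (auto simp: nth e_code)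
    then show ?thesis
      using P[OF ex_orbit_closed] by (simp add: least_orbit_entries image_primitive_eq_nielsen[OF G q])
  qed
  then show ?thesis by blast
qed

end
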